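(* Let $(\Omega,\mathcal{F},\mathbb{P},(\mathcal{F}_t)_{t\ge 0})$ be a filtered probability space such that $(\Omega,\mathcal{F},(\mathcal{F}_t)_{t\ge 0})$ satisfies property (P), and let $(X_t)_{t\ge 0}$ be a (true) submartingale of class $(\Sigma)$ defined on it (in particular, $X_t$ is integrable for all $t\ge 0$). Let $g:=\sup\{t\ge 0 : X_t=0\}$. Then there exists a unique $\sigma$-finite measure $\mathcal{Q}$ on $(\Omega,\mathcal{F})$ such that: (i) $\mathcal{Q}[g=\infty]=0$; (ii) for all $t\ge 0$ and all bounded $\mathcal{F}_t$-measurable random variables $F_t$, $$\mathcal{Q}\left[F_t\,\mathbf{1}_{g\le t}\right]=\mathbb{E}_{\mathbb{P}}\left[F_tX_t\right].$$
   Context: Property (P). Let $(\Omega,\mathcal{F},(\mathcal{F}_t)_{t\ge0})$ be a filtered measurable space such that $\mathcal{F}=\bigvee_{t\ge0}\mathcal{F}_t$ is the $\sigma$-algebra generated by all $\mathcal{F}_t$, $t\ge 0$. It satisfies property (P) if $\mathcal{F}_t=\mathcal{G}_{t+}:=\bigcap_{s>t}\mathcal{G}_s$ for all $t\ge0$, where $(\mathcal{G}_t)_{t\ge0}$ is a filtration such that: (1) for all $t\ge0$, $\mathcal{G}_t$ is generated by a countable number of sets; (2) for all $t\ge0$, there exist a Polish space $\Omega_t$ and a surjective map $\pi_t:\Omega\to\Omega_t$ such that $\mathcal{G}_t$ is the $\sigma$-algebra of inverse images by $\pi_t$ of Borel sets of $\Omega_t$, and such that for all $B\in\mathcal{G}_t$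 and $\omega\in\Omega$, $\pi_t(\omega)\in\pi_t(B)$ implies $\omega\in B$; (3) if $(\omega_n)_{n\ge0}$ is a sequence of elements of $\Omega$ such that $\bigcap_{n=0}^N A_n(\omega_n)\neq\emptyset$ for all $N\ge0$, where $A_n(\omega_n)$ denotes the intersection of all sets in $\mathcal{G}_n$ containing $\omega_n$, then $\bigcap_{n=0}^\infty A_n(\omega_n)\neq\emptyset$. The filtration $(\mathcal{F}_t)$ is then right-continuous; it is not assumed to be complete. Class $(\Sigma)$. A nonnegative submartingale $(X_t)_{t\ge0}$ is of class $(\Sigma)$ if $X_t=N_t+A_t$, where $(N_t)$ and $(A_t)$ are $(\mathcal{F}_t)$-adapted, $(N_t)_{t\ge0}$ is a càdlàg martingale, $(A_t)_{t\ge0}$ is a continuous increasing process with $A_0=0$, and the measure $(dA_t)$ is carried by the set $\{t\ge0: X_t=0\}$. Conventions: for a measure $\mathcal{Q}$ and a function $F$, $\mathcal{Q}[F]$ denotes $\int F\,d\mathcal{Q}$, and $\mathcal{Q}[\Lambda]$ the measure of the event $\Lambda$. $\sup\emptyset=0$. Events involving $g$ are understood as measurable with respect to the completion of $\mathcal{F}$ under the measure considered. *)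

theory Defs
  imports "HOL-Probability.Probability"
begin

text \<open>A \<open>\<sigma>\<close>-algebra is represented by a \<^typ>\<open>'a measure\<close> of which only the space and the measurable
  sets matter. Families indexed by the half-line are functions on \<^typ>\<open>real\<close> whose values at negative
  times are irrelevant; \<^term>\<open>max 0 t\<close> is what makes the library's notion ignore them.\<close>

definition filtration_on_halfline :: "'a set \<Rightarrow> (real \<Rightarrow> 'a measure) \<Rightarrow> bool" where
  "filtration_on_halfline \<Omega> F \<longleftrightarrow> filtration \<Omega> (\<lambda>t. F (max 0 t))"

lemma filtration_on_halfline_iff:
  "filtration_on_halfline \<Omega> F \<longleftrightarrow>
     (\<forall>t\<ge>0. space (F t) = \<Omega>) \<and> (\<forall>s t. 0 \<le> s \<and> s \<le> t \<longrightarrow> sets (F s) \<subseteq> sets (F t))"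
proof
  assume "filtration_on_halfline \<Omega> F"
  then interpret filtration \<Omega> "\<lambda>t. F (max 0 t)"
    by (simp add: filtration_on_halfline_def)
  show "(\<forall>t\<ge>0. space (F t) = \<Omega>) \<and> (\<forall>s t. 0 \<le> s \<and> s \<le> t \<longrightarrow> sets (F s) \<subseteq> sets (F t))"
  proof (intro conjI allI impI)
    fix t :: real assume "0 \<le> t"
    then show "space (F t) = \<Omega>" using space_F[of t] by (simp add: max_def)
  next
    fix s t :: real assume "0 \<le> s \<and> s \<le> t"
    then show "sets (F s) \<subseteq> sets (F t)" using sets_F_mono[of s t] by (simp add: max_def)
  qed
next
  assume "(\<forall>t\<ge>0. space (F t) = \<Omega>) \<and> (\<forall>s t. 0 \<le> s \<and> s \<le> t \<longrightarrow> sets (F s) \<subseteq> sets (F t))"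
  then show "filtration_on_halfline \<Omega> F"
    unfolding filtration_on_halfline_def by unfold_locales auto
qed

definition polish_topology :: "'a topology \<Rightarrow> bool" where
  "polish_topology T \<longleftrightarrow> completely_metrizable_space T \<and> separable_space T"

definition borel_of_topology :: "'a topology \<Rightarrow> 'a measure" where
  "borel_of_topology T = sigma (topspace T) {U. openin T U}"

lemma sets_borel_of_topology:
  "sets (borel_of_topology T) = sigma_sets (topspace T) {U. openin T U}"
  unfolding borel_of_topology_def by (rule sets_measure_of) (blast dest: openin_subset)

definition polish_quotient_map :: "'a measure \<Rightarrow> ('a \<Rightarrow> 'b) \<Rightarrow> 'b topology \<Rightarrow> bool" where
  "polish_quotient_map G \<pi> T \<longleftrightarrow>
     polish_topology T \<and>
     \<pi> ` space G = topspace T \<and>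
     sets G = {\<pi> -` B \<inter> space G | B. B \<in> sets (borel_of_topology T)} \<and>
     (\<forall>B\<in>sets G. \<forall>\<omega>\<in>space G. \<pi> \<omega> \<in> \<pi> ` B \<longrightarrow> \<omega> \<in> B)"

text \<open>Since \<open>\<pi>\<close> is surjective, the underlying set of the Polish space can always be taken to be a
  subset of \<open>\<Omega>\<close>, so in property (P) it is no restriction to look for the topology on the type of the
  elements of \<open>\<Omega>\<close>:\<close>

lemma polish_quotient_map_same_type:
  fixes \<pi> :: "'a \<Rightarrow> 'b" and T :: "'b topology"
  assumes "polish_quotient_map G \<pi> T"
  shows "\<exists>(\<pi>' :: 'a \<Rightarrow> 'a) T'. polish_quotient_map G \<pi>' T'"
proof -
  let ?\<Omega> = "space G"
  define \<sigma> where "\<sigma> = inv_into ?\<Omega> \<pi>"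
  define S where "S = \<sigma> ` topspace T"
  define T' where "T' = pullback_topology S \<pi> T"
  define \<pi>' where "\<pi>' = (\<lambda>\<omega>. \<sigma> (\<pi> \<omega>))"
  note props = assms[unfolded polish_quotient_map_def]
  note polish = props[THEN conjunct1]
    and surj = props[THEN conjunct2, THEN conjunct1]
    and sets_G = props[THEN conjunct2, THEN conjunct2, THEN conjunct1]
    and sat = props[THEN conjunct2, THEN conjunct2, THEN conjunct2]
  have right_inv: "\<pi> (\<sigma> y) = y" if "y \<in> topspace T" for y
    unfolding \<sigma>_def by (rule f_inv_into_f) (simp add: surj that)
  have topspace_T': "topspace T' = S"
    unfolding T'_def topspace_pullback_topology S_def by (auto simp: right_inv)
  have "continuous_map T' T (id \<circ> \<pi>)"
    unfolding T'_def by (rule continuous_map_pullback) (rule continuous_map_id)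
  moreover have "continuous_map T T' \<sigma>"
    unfolding T'_def
  proof (rule continuous_map_pullback')
    show "continuous_map T T (\<pi> \<circ> \<sigma>)"
      by (rule continuous_map_eq[OF continuous_map_id]) (simp add: right_inv)
    show "topspace T \<subseteq> \<sigma> -` S" by (auto simp: S_def)
  qed
  ultimately have homeo: "homeomorphic_maps T T' \<sigma> \<pi>"
    unfolding homeomorphic_maps_def topspace_T' by (simp add: S_def right_inv)
  then have "T homeomorphic_space T'"
    unfolding homeomorphic_space_def by blast
  moreover have "separable_space T'"
  proof (rule separable_space_continuous_map_image[of T T' \<sigma>])
    show "separable_space T" using polish by (simp add: polish_topology_def)
    show "continuous_map T T' \<sigma>" by fact
    show "\<sigma> ` topspace T = topspace T'" by (simp add: topspace_T' S_def)
  qed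
  ultimately have "polish_topology T'"
    using polish homeomorphic_completely_metrizable_space unfolding polish_topology_def by blast
  moreover have "\<pi>' ` ?\<Omega> = topspace T'"
    unfolding \<pi>'_def topspace_T' S_def surj[symmetric] by (simp add: image_image)
  moreover have "sets G = {\<pi>' -` B \<inter> ?\<Omega> | B. B \<in> sets (borel_of_topology T')}"
  proof -
    have borel': "sets (borel_of_topology T') = {\<pi> -` B \<inter> S | B. B \<in> sets (borel_of_topology T)}"
    proof -
      have maps: "\<pi> \<in> S \<rightarrow> topspace T" by (auto simp: S_def right_inv)
      have gen: "{U. openin T' U} = {\<pi> -` U \<inter> S | U. U \<in> {U. openin T U}}"
        unfolding T'_def openin_pullback_topology by auto
      show ?thesis
        unfolding sets_borel_of_topology topspace_T' gen
        using sigma_sets_vimage_commute[OF maps, of "{U. openin T U}"] by simp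
    qed
    have vimage_eq: "\<pi>' -` (\<pi> -` B \<inter> S) \<inter> ?\<Omega> = \<pi> -` B \<inter> ?\<Omega>" for B
    proof -
      have "\<pi> (\<pi>' \<omega>) = \<pi> \<omega>" "\<pi>' \<omega> \<in> S" if "\<omega> \<in> ?\<Omega>" for \<omega>
      proof -
        have "\<pi> \<omega> \<in> topspace T" using that surj by blast
        then show "\<pi> (\<pi>' \<omega>) = \<pi> \<omega>" "\<pi>' \<omega> \<in> S"
          unfolding \<pi>'_def S_def by (simp_all add: right_inv)
      qed
      then show ?thesis by auto
    qed
    have "{\<pi>' -` B \<inter> ?\<Omega> | B. B \<in> sets (borel_of_topology T')} =
        {\<pi>' -` (\<pi> -` B \<inter> S) \<inter> ?\<Omega> | B. B \<in> sets (borel_of_topology T)}"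
      unfolding borel' by blast
    then show ?thesis by (simp only: vimage_eq sets_G)
  qed
  moreover have "\<omega> \<in> B" if B: "B \<in> sets G" and \<omega>: "\<omega> \<in> ?\<Omega>" and im: "\<pi>' \<omega> \<in> \<pi>' ` B" for B \<omega>
  proof -
    obtain b where b: "b \<in> B" "\<pi>' \<omega> = \<pi>' b" using im by blast
    have "b \<in> ?\<Omega>" using b(1) B sets.sets_into_space by blast
    then have "\<pi> \<omega> \<in> topspace T" "\<pi> b \<in> topspace T" using \<omega> surj by blast+
    then have "\<pi> \<omega> = \<pi> b"
      using b(2) right_inv unfolding \<pi>'_def by metis
    then show ?thesis using sat B \<omega> b(1) by blast
  qed
  ultimately show ?thesis
    unfolding polish_quotient_map_def by blast
qed

definition atom_of :: "'a measure \<Rightarrow> 'a \<Rightarrow> 'a set" where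
  "atom_of G \<omega> = \<Inter>{B \<in> sets G. \<omega> \<in> B}"

definition property_P :: "'a measure \<Rightarrow> (real \<Rightarrow> 'a measure) \<Rightarrow> bool" where
  "property_P M F \<longleftrightarrow>
     filtration_on_halfline (space M) F \<and>
     sets M = sigma_sets (space M) (\<Union>t\<in>{0..}. sets (F t)) \<and>
     (\<exists>G. filtration_on_halfline (space M) G \<and>
          (\<forall>t\<ge>0. sets (F t) = (\<Inter>s\<in>{t<..}. sets (G s))) \<and>
          (\<forall>t\<ge>0. \<exists>C. countable C \<and> C \<subseteq> Pow (space M) \<and> sets (G t) = sigma_sets (space M) C) \<and>
          (\<forall>t\<ge>0. \<exists>(\<pi> :: 'a \<Rightarrow> 'a) T. polish_quotient_map (G t) \<pi> T) \<and>
          (\<forall>\<omega> :: nat \<Rightarrow> 'a. range \<omega> \<subseteq> space M \<and>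
              (\<forall>N. (\<Inter>n\<le>N. atom_of (G (real n)) (\<omega> n)) \<noteq> {}) \<longrightarrow>
              (\<Inter>n. atom_of (G (real n)) (\<omega> n)) \<noteq> {}))"

definition adapted :: "(real \<Rightarrow> 'a measure) \<Rightarrow> (real \<Rightarrow> 'a \<Rightarrow> real) \<Rightarrow> bool" where
  "adapted F X \<longleftrightarrow> (\<forall>t\<ge>0. X t \<in> borel_measurable (F t))"

definition martingale :: "'a measure \<Rightarrow> (real \<Rightarrow> 'a measure) \<Rightarrow> (real \<Rightarrow> 'a \<Rightarrow> real) \<Rightarrow> bool" where
  "martingale P F X \<longleftrightarrow>
     adapted F X \<and> (\<forall>t\<ge>0. integrable P (X t)) \<and>
     (\<forall>s t. 0 \<le> s \<and> s \<le> t \<longrightarrow> (AE \<omega> in P. real_cond_exp P (F s) (X t) \<omega> = X s \<omega>))"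

definition submartingale :: "'a measure \<Rightarrow> (real \<Rightarrow> 'a measure) \<Rightarrow> (real \<Rightarrow> 'a \<Rightarrow> real) \<Rightarrow> bool" where
  "submartingale P F X \<longleftrightarrow>
     adapted F X \<and> (\<forall>t\<ge>0. integrable P (X t)) \<and>
     (\<forall>s t. 0 \<le> s \<and> s \<le> t \<longrightarrow> (AE \<omega> in P. X s \<omega> \<le> real_cond_exp P (F s) (X t) \<omega>))"

definition cadlag :: "(real \<Rightarrow> real) \<Rightarrow> bool" where
  "cadlag x \<longleftrightarrow>
     (\<forall>t\<ge>0. (x \<longlongrightarrow> x t) (at_right t)) \<and> (\<forall>t>0. \<exists>l. (x \<longlongrightarrow> l) (at_left t))"

text \<open>The measure \<open>dA\<close> of a continuous increasing \<open>a\<close> with \<open>a 0 = 0\<close>. Extending \<open>a\<close> by the constant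
  \<open>a 0\<close> to negative times makes \<^const>\<open>interval_measure\<close> applicable and puts no mass on them.\<close>

definition stieltjes_halfline :: "(real \<Rightarrow> real) \<Rightarrow> real measure" where
  "stieltjes_halfline a = interval_measure (\<lambda>t. a (max 0 t))"

text \<open>Path properties are required of every path, not just of almost every one.\<close>

definition class_Sigma :: "'a measure \<Rightarrow> (real \<Rightarrow> 'a measure) \<Rightarrow> (real \<Rightarrow> 'a \<Rightarrow> real) \<Rightarrow> bool" where
  "class_Sigma P F X \<longleftrightarrow>
     submartingale P F X \<and>
     (\<forall>t\<ge>0. \<forall>\<omega>\<in>space P. 0 \<le> X t \<omega>) \<and>
     (\<exists>N A. adapted F N \<and> adapted F A \<and>
        (\<forall>t\<ge>0. \<forall>\<omega>\<in>space P. X t \<omega> = N t \<omega> + A t \<omega>) \<and>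
        martingale P F N \<and> (\<forall>\<omega>\<in>space P. cadlag (\<lambda>t. N t \<omega>)) \<and>
        (\<forall>\<omega>\<in>space P. A 0 \<omega> = 0 \<and> continuous_on {0..} (\<lambda>t. A t \<omega>) \<and> mono_on {0..} (\<lambda>t. A t \<omega>) \<and>
           (AE t in stieltjes_halfline (\<lambda>t. A t \<omega>). t \<in> {t. 0 \<le> t \<and> X t \<omega> = 0})))"

text \<open>The supremum is taken in \<^typ>\<open>ennreal\<close>, where the supremum of the empty set is \<open>0\<close>.\<close>

definition last_zero :: "(real \<Rightarrow> 'a \<Rightarrow> real) \<Rightarrow> 'a \<Rightarrow> ennreal" where
  "last_zero X \<omega> = (SUP t\<in>{t. 0 \<le> t \<and> X t \<omega> = 0}. ennreal t)"

end

theory Submission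
  imports Defs
begin

text \<open>As long as \<open>A\<close> stays constant \<open>X\<close> is a martingale, and \<open>X\<close> vanishes at every time from which \<open>A\<close>
  increases. Hence for fixed \<open>s\<close> the measures with density \<open>X\<^sub>t 1{A\<^sub>t = A\<^sub>s}\<close> on \<open>\<F>\<^sub>t\<close>, \<open>t \<ge> s\<close>, are
  consistent, and property (P) yields a finite measure \<open>\<nu>\<^sub>s\<close> extending all of them. It is carried by
  \<open>{A\<^sub>\<infinity> = A\<^sub>s}\<close> and increases with \<open>s\<close>; \<open>\<Q>\<close> is the supremum of the \<open>\<nu>\<^sub>n\<close>. The event \<open>{g \<le> s}\<close> is
  contained in \<open>{A\<^sub>\<infinity> = A\<^sub>s}\<close>, and the difference is null for every candidate for \<open>\<Q>\<close>: by a maximal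
  inequality, \<open>X\<close> does not come arbitrarily close to \<open>0\<close> while \<open>A\<close> is constant unless it ends at \<open>0\<close>, an
  event without mass under the density \<open>X\<^sub>t\<close>. So the values of \<open>\<Q>\<close> on \<open>{A\<^sub>\<infinity> = A\<^sub>s}\<close> are prescribed, and
  these events exhaust the space up to a null set.\<close>

subsection \<open>Compact regularity of measures on Polish quotients\<close>

text \<open>The consistency is optional stopping at the time when \<open>A\<close> leaves its value
  at \<open>s\<close>. It is carried out on a grid, where the cell of departure is known at its
  right end, so that only the martingale property at fixed times enters. At that right end
  \<open>X\<close> tends to 0 pathwise, but no integrable majorant is at hand; hence it is truncated
  at \<open>K\<close>, and the excess \<open>max 0 (X - K)\<close>, again a submartingale, is pushed
  to the final time, where it is small uniformly in the grid. A second obstacle is measurability: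
  \<open>{g \<le> t}\<close> is defined through uncountably many times, and \<open>X\<close> may
  reach 0 without \<open>A\<close> moving, for instance when it is absorbed there. Rational times
  and positive thresholds replace exact zeros. Property (P) gives structure to \<open>G\<close>, not
  to \<open>F\<close>; but \<open>F t\<close> lies between \<open>G t\<close> and \<open>G s\<close>
  for all s > t, so extending along \<open>G\<close> at integer times suffices. Compactness is
  available only level by level in the Polish quotients; condition (3) glues together the points
  found at the single levels.\<close>

lemma decseq_emeasure_less:
  assumes "finite_measure M" "range A \<subseteq> sets M" "decseq A" "emeasure M (\<Inter>i. A i) < e"
  shows "\<exists>n. emeasure M (A n) < e"
proof -
  interpret finite_measure M by fact
  have "(\<lambda>i. emeasure M (A i)) \<longlonglongrightarrow> emeasure M (\<Inter>i. A i)"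
    using assms by (intro Lim_emeasure_decseq) auto
  from order_tendstoD(2)[OF this assms(4)] show ?thesis
    by (auto simp: eventually_sequentially)
qed

lemma suminf_ennreal_geometric: "(\<Sum>n. ennreal (e / 2 ^ Suc n)) = ennreal e" if "0 \<le> e"
proof -
  have "(\<lambda>n. e * (1/2) ^ Suc n) sums (e * 1)"
    by (intro sums_mult power_half_series)
  then have "(\<lambda>n. e / 2 ^ Suc n) sums e"
    by (simp add: power_one_over field_simps)
  then show ?thesis
    using that by (subst suminf_ennreal_eq[of _ e]) auto
qed

lemma emeasure_UN_less_geometric:
  assumes "range A \<subseteq> sets M" "\<And>n. emeasure M (A n) < ennreal (e / 2 ^ Suc n)" "0 < e"
  shows "emeasure M (\<Union>n. A n) \<le> ennreal e"
proof -
  have "emeasure M (\<Union>n. A n) \<le> (\<Sum>n. emeasure M (A n))"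
    by (rule emeasure_subadditive_countably) fact
  also have "\<dots> \<le> (\<Sum>n. ennreal (e / 2 ^ Suc n))"
    using less_imp_le[OF assms(2)] by (rule suminf_le) simp_all
  also have "\<dots> = ennreal e" using assms(3) by (intro suminf_ennreal_geometric) simp
  finally show ?thesis .
qed

text \<open>The sets that can be approximated by closed sets from inside and from outside at once
  form a sigma-algebra: complements exchange \<open>C\<close> and \<open>D\<close>. Open sets belong
  to it because they are F-sigma in a metrizable space.\<close>

lemma closed_regular_of_metrizable:
  assumes T: "metrizable_space T"
    and fin: "finite_measure \<mu>" and sets: "sets \<mu> = sets (borel_of_topology T)"
    and B: "B \<in> sets \<mu>" and "0 < e"
  shows "\<exists>C D. closedin T C \<and> closedin T D \<and> C \<subseteq> B \<and> D \<subseteq> topspace T - B \<and>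
           emeasure \<mu> (topspace T - (C \<union> D)) < ennreal e"
proof -
  interpret finite_measure \<mu> by fact
  have op: "U \<in> sets \<mu>" if "openin T U" for U
    using that by (auto simp: sets sets_borel_of_topology)
  have top: "topspace T \<in> sets \<mu>" by (rule op) simp
  have cl: "C \<in> sets \<mu>" if "closedin T C" for C
  proof -
    have "topspace T - (topspace T - C) = C"
      using closedin_subset[OF that] by blast
    then show ?thesis
      using op[of "topspace T - C"] that top by (metis closedin_def sets.Diff)
  qed
  have "B \<in> sigma_sets (topspace T) {U. openin T U}"
    using B by (simp add: sets sets_borel_of_topology)
  then show ?thesis
    using \<open>0 < e\<close>
  proof (induction arbitrary: e)
    case (Basic U)
    then have U: "openin T U" by simp
    then obtain C where C: "\<And>n. closedin T (C n)" "\<And>n. C n \<subseteq> C (Suc n)" "(\<Union>n. C n) = U"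
      using open_imp_fsigma_in[OF T U] by (auto simp: fsigma_in_ascending)
    have "decseq (\<lambda>n. U - C n)"
      using C(2) by (intro decseq_SucI) blast
    moreover have "(\<Inter>n. U - C n) = {}" using C(3) by auto
    ultimately obtain n where n: "emeasure \<mu> (U - C n) < ennreal e"
      using decseq_emeasure_less[OF fin, of "\<lambda>n. U - C n" "ennreal e"] op[OF U] cl[OF C(1)] Basic
      by (auto simp del: INT_simps)
    have "topspace T - (C n \<union> (topspace T - U)) = U - C n"
      using openin_subset[OF U] by blast
    then show ?case
      using n C U by (intro exI[of _ "C n"] exI[of _ "topspace T - U"]) auto
  next
    case Empty
    then show ?case by (intro exI[of _ "{}"] exI[of _ "topspace T"]) auto
  next
    case (Compl B)
    from Compl.IH[OF Compl.prems] obtain C D where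
      "closedin T C" "closedin T D" "C \<subseteq> B" "D \<subseteq> topspace T - B"
      "emeasure \<mu> (topspace T - (C \<union> D)) < ennreal e" by blast
    moreover from this have "C \<subseteq> topspace T - (topspace T - B)" using closedin_subset by blast
    ultimately show ?case
      by (intro exI[of _ D] exI[of _ C]) (auto simp: Un_commute)
  next
    case (Union B)
    have "\<forall>n. \<exists>C D. closedin T C \<and> closedin T D \<and> C \<subseteq> B n \<and> D \<subseteq> topspace T - B n \<and>
           emeasure \<mu> (topspace T - (C \<union> D)) < ennreal ((e/2) / 2 ^ Suc n)"
      using Union.IH Union.prems by simp
    then obtain C D where CD: "\<And>n. closedin T (C n)" "\<And>n. closedin T (D n)" "\<And>n. C n \<subseteq> B n"
      "\<And>n. D n \<subseteq> topspace T - B n"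
      "\<And>n. emeasure \<mu> (topspace T - (C n \<union> D n)) < ennreal ((e/2) / 2 ^ Suc n)"
      by metis
    have D: "closedin T (\<Inter>n. D n)" by (intro closedin_Inter) (auto simp: CD)
    \<comment> \<open>The union of all \<open>C i\<close> need not be closed, so it is cut off at
      \<open>n\<close>. The sets \<open>E n\<close> decrease to a subset of the union of the single
      errors, which has mass at most e/2; hence some \<open>E n\<close> has mass below e.\<close>
    define E where "E n = topspace T - ((\<Union>i\<le>n. C i) \<union> (\<Inter>n. D n))" for n
    have Cn: "closedin T (\<Union>i\<le>n. C i)" for n by (intro closedin_Union) (auto simp: CD)
    have "(\<Inter>n. E n) \<subseteq> (\<Union>n. topspace T - (C n \<union> D n))"
      unfolding E_def by auto
    moreover have S: "(\<Union>n. topspace T - (C n \<union> D n)) \<in> sets \<mu>"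
      using top cl CD by (intro sets.countable_UN) auto
    ultimately have "emeasure \<mu> (\<Inter>n. E n) \<le> emeasure \<mu> (\<Union>n. topspace T - (C n \<union> D n))"
      by (rule emeasure_mono)
    also have "\<dots> \<le> ennreal (e/2)"
      using Union.prems top cl CD by (intro emeasure_UN_less_geometric) auto
    also have "\<dots> < ennreal e" using Union.prems by (simp add: ennreal_less_iff)
    finally obtain n where n: "emeasure \<mu> (E n) < ennreal e"
      using decseq_emeasure_less[OF fin, of E "ennreal e"] top cl[OF Cn] cl[OF D]
      by (force simp: E_def decseq_def)
    show ?case
    proof (intro exI conjI)
      show "closedin T (\<Union>i\<le>n. C i)" "closedin T (\<Inter>n. D n)" by fact+
      show "(\<Union>i\<le>n. C i) \<subseteq> \<Union>(range B)" using CD(3) by auto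
      show "(\<Inter>n. D n) \<subseteq> topspace T - \<Union>(range B)" using CD(4) by blast
      show "emeasure \<mu> (topspace T - ((\<Union>i\<le>n. C i) \<union> (\<Inter>n. D n))) < ennreal e"
        using n by (simp add: E_def)
    qed
  qed
qed

text \<open>\<open>K\<close> is closed and totally bounded in a complete space.\<close>

lemma (in Metric_space) compactin_Inter_finite_UN_mcball:
  fixes J :: "nat \<Rightarrow> 'a set"
  assumes "mcomplete" "\<And>m. finite (J m)" "K = (\<Inter>m. \<Union>a\<in>J m. mcball a (1 / Suc m))"
  shows "compactin mtopology K"
proof -
  have "closedin mtopology K"
    unfolding assms(3) by (intro closedin_Inter) (auto intro!: closedin_Union simp: assms(2))
  then have KM: "K \<subseteq> M" "mtopology closure_of K = K"
    using closedin_subset[of mtopology K] by (auto simp: closure_of_closedin)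
  have "mtotally_bounded K"
    unfolding mtotally_bounded_def
  proof (intro allI impI)
    fix e :: real assume "0 < e"
    then obtain m where m: "1 / Suc m < e / 2"
      by (metis half_gt_zero nat_approx_posE)
    \<comment> \<open>Total boundedness asks for centres in \<open>K\<close>, which the points of
      \<open>J m\<close> need not be. Each useful ball gets a new centre in \<open>K\<close>, which
      doubles the radius; this is why \<open>1 / Suc m\<close> was taken below
      \<open>e / 2\<close>.\<close>
    define c where "c a = (SOME x. x \<in> K \<inter> mcball a (1 / Suc m))" for a
    define J' where "J' = {a \<in> J m. K \<inter> mcball a (1 / Suc m) \<noteq> {}}"
    have c: "c a \<in> K \<inter> mcball a (1 / Suc m)" if "a \<in> J'" for a
      unfolding c_def by (rule someI_ex) (use that in \<open>auto simp: J'_def\<close>)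
    have "x \<in> (\<Union>x\<in>c ` J'. mball x e)" if "x \<in> K" for x
    proof -
      from that obtain a where a: "a \<in> J m" "x \<in> mcball a (1 / Suc m)"
        by (auto simp: assms(3))
      then have "a \<in> J'" using that by (auto simp: J'_def)
      with c[of a] a have "d (c a) x \<le> d (c a) a + d a x" "d a (c a) \<le> 1 / Suc m" "d a x \<le> 1 / Suc m"
        "c a \<in> M" "x \<in> M"
        by (auto simp: mcball_def triangle)
      then have "c a \<in> M" "x \<in> M" "d (c a) x < e" using m by (auto simp: commute)
      then show ?thesis using \<open>a \<in> J'\<close> by (auto simp: mball_def)
    qed
    moreover have "finite (c ` J')" "c ` J' \<subseteq> K"
      using c assms(2)[of m] by (auto simp: J'_def)
    ultimately show "\<exists>F. finite F \<and> F \<subseteq> K \<and> K \<subseteq> (\<Union>x\<in>F. mball x e)"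
      by (intro exI[of _ "c ` J'"]) blast
  qed
  then show ?thesis
    using assms(1) mtotally_bounded_eq_compact_closure_of KM by auto
qed

text \<open>Ulam's argument: for each \<open>m\<close>, finitely many balls of radius
  \<open>1 / Suc m\<close> around a dense sequence miss only mass \<open>(e/2) / 2 ^ Suc m\<close>,
  and what lies in all these finite unions is compact.\<close>

lemma tight_of_polish:
  assumes T: "polish_topology T"
    and fin: "finite_measure \<mu>" and sets: "sets \<mu> = sets (borel_of_topology T)" and "0 < e"
  shows "\<exists>K. compactin T K \<and> closedin T K \<and> emeasure \<mu> (topspace T - K) < ennreal e"
proof -
  interpret finite_measure \<mu> by fact
  obtain M d where "Metric_space M d" and compl: "Metric_space.mcomplete M d"
    and Td: "T = Metric_space.mtopology M d"
    using T by (auto simp: polish_topology_def completely_metrizable_space_def)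
  interpret Metric_space M d by fact
  have top: "topspace T = M" by (simp add: Td)
  have op: "U \<in> sets \<mu>" if "openin T U" for U
    using that by (auto simp: sets sets_borel_of_topology)
  have topm: "M \<in> sets \<mu>" using op[of M] openin_topspace[of T] by (simp add: top)
  have cl: "C \<in> sets \<mu>" if "closedin T C" for C
  proof -
    have "M - (M - C) = C" using closedin_subset[OF that] by (auto simp: top)
    then show ?thesis
      using op[of "M - C"] that topm by (metis closedin_def sets.Diff top)
  qed
  show ?thesis
  proof (cases "M = {}")
    case True
    then show ?thesis
      using \<open>0 < e\<close> by (intro exI[of _ "{}"]) (auto simp: top)
  next
    case False
    obtain S where S: "countable S" "S \<subseteq> M" "T closure_of S = M"
      using T by (auto simp: polish_topology_def separable_space_def top)
    then have "S \<noteq> {}" using False by auto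
    then obtain a where a: "S = range (a :: nat \<Rightarrow> _)"
      using S(1) uncountable_def by blast
    have cover: "M \<subseteq> (\<Union>j. mcball (a j) r)" if "0 < r" for r
    proof
      fix x assume "x \<in> M"
      then have "x \<in> mtopology closure_of S" using S by (simp add: Td)
      then obtain y where "y \<in> S" "y \<in> mball x r"
        using \<open>0 < r\<close> unfolding metric_closure_of by auto
      then show "x \<in> (\<Union>j. mcball (a j) r)"
        using a by (auto simp: mball_def mcball_def commute less_imp_le)
    qed
    have "\<exists>n. emeasure \<mu> (M - (\<Union>j\<le>n. mcball (a j) (1 / Suc m))) < ennreal ((e/2) / 2 ^ Suc m)" for m
    proof (rule decseq_emeasure_less[OF fin])
      show "range (\<lambda>n. M - (\<Union>j\<le>n. mcball (a j) (1 / Suc m))) \<subseteq> sets \<mu>"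
        using topm cl by (auto intro!: sets.Diff sets.finite_UN simp: Td)
      show "decseq (\<lambda>n. M - (\<Union>j\<le>n. mcball (a j) (1 / Suc m)))"
        by (force simp: decseq_def)
      have "(\<Inter>n. M - (\<Union>j\<le>n. mcball (a j) (1 / Suc m))) = {}"
        using cover[of "1 / Suc m"] by auto
      then show "emeasure \<mu> (\<Inter>n. M - (\<Union>j\<le>n. mcball (a j) (1 / Suc m))) < ennreal ((e/2) / 2 ^ Suc m)"
        using \<open>0 < e\<close> by (simp del: INT_simps)
    qed
    then obtain n where n: "\<And>m. emeasure \<mu> (M - (\<Union>j\<le>n m. mcball (a j) (1 / Suc m))) < ennreal ((e/2) / 2 ^ Suc m)"
      by metis
    define K where "K = (\<Inter>m. \<Union>x\<in>a ` {..n m}. mcball x (1 / Suc m))"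
    have comp: "compactin T K"
      unfolding Td by (rule compactin_Inter_finite_UN_mcball[OF compl _ K_def]) simp
    moreover have "closedin T K"
      using comp Hausdorff_space_mtopology by (simp add: Td compactin_imp_closedin)
    moreover have "emeasure \<mu> (M - K) < ennreal e"
    proof -
      have "M - K = (\<Union>m. M - (\<Union>j\<le>n m. mcball (a j) (1 / Suc m)))"
        by (auto simp: K_def)
      also have "emeasure \<mu> \<dots> \<le> ennreal (e/2)"
        using \<open>0 < e\<close> topm cl n
        by (intro emeasure_UN_less_geometric) (auto intro!: sets.Diff sets.finite_UN simp: Td)
      also have "\<dots> < ennreal e" using \<open>0 < e\<close> by (simp add: ennreal_less_iff)
      finally show ?thesis .
    qed
    ultimately show ?thesis by (auto simp: top)
  qed
qed

text \<open>Intersecting the closed approximations with a compact set that carries almost all mass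
  makes them compact; each of the two operations may cost half of \<open>e\<close>.\<close>

lemma compact_regular_of_polish:
  assumes T: "polish_topology T"
    and fin: "finite_measure \<mu>" and sets: "sets \<mu> = sets (borel_of_topology T)"
    and B: "B \<in> sets \<mu>" and "0 < e"
  shows "\<exists>C D. compactin T C \<and> closedin T C \<and> compactin T D \<and> closedin T D \<and> C \<subseteq> B \<and>
           D \<subseteq> topspace T - B \<and> emeasure \<mu> (topspace T - (C \<union> D)) < ennreal e"
proof -
  interpret finite_measure \<mu> by fact
  have "metrizable_space T"
    using T by (auto simp: polish_topology_def completely_metrizable_imp_metrizable_space)
  from closed_regular_of_metrizable[OF this fin sets B, of "e/2"] \<open>0 < e\<close>
  obtain C D where CD: "closedin T C" "closedin T D" "C \<subseteq> B" "D \<subseteq> topspace T - B"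
           "emeasure \<mu> (topspace T - (C \<union> D)) < ennreal (e/2)" by auto
  from tight_of_polish[OF T fin sets, of "e/2"] \<open>0 < e\<close>
  obtain K where K: "compactin T K" "closedin T K" "emeasure \<mu> (topspace T - K) < ennreal (e/2)"
    by auto
  have op: "U \<in> sets \<mu>" if "openin T U" for U
    using that by (auto simp: sets sets_borel_of_topology)
  have "topspace T - (C \<union> D) \<in> sets \<mu>" "topspace T - K \<in> sets \<mu>"
    by (rule op, simp add: CD K openin_diff closedin_Un)+
  note meas = this
  have "topspace T - ((K \<inter> C) \<union> (K \<inter> D)) = (topspace T - (C \<union> D)) \<union> (topspace T - K)"
    by blast
  then have "emeasure \<mu> (topspace T - ((K \<inter> C) \<union> (K \<inter> D)))
      \<le> emeasure \<mu> (topspace T - (C \<union> D)) + emeasure \<mu> (topspace T - K)"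
    using emeasure_subadditive[OF meas] by simp
  also have "\<dots> < ennreal (e/2) + ennreal (e/2)"
    using CD(5) K(3) by (rule add_strict_mono)
  also have "\<dots> = ennreal e"
    using \<open>0 < e\<close> by (simp flip: ennreal_plus)
  finally show ?thesis
    using CD(3,4) CD(1,2)[THEN closedin_Int[OF K(2)]] CD(1,2)[THEN compact_Int_closedin[OF K(1)]]
    by blast
qed

text \<open>The sets that do not separate \<open>x\<close> from \<open>y\<close> form a
  sigma-algebra, so generators decide whether two points share an atom. With countably many
  generators an atom becomes a sequence of signs.\<close>

lemma atom_of_memI:
  assumes "sets G = sigma_sets \<Omega> C" "C \<subseteq> Pow \<Omega>" "x \<in> \<Omega>" "y \<in> \<Omega>" "\<And>B. B \<in> C \<Longrightarrow> x \<in> B \<longleftrightarrow> y \<in> B"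
  shows "y \<in> atom_of G x"
proof -
  have "x \<in> B \<longleftrightarrow> y \<in> B" if "B \<in> sigma_sets \<Omega> C" for B
    using that by induction (use assms in auto)
  then show ?thesis
    using assms(1) by (auto simp: atom_of_def)
qed

text \<open>The compact approximations of countably many sets from inside and from outside leave a set
  \<open>Z\<close> of almost full measure on which every consistent pattern of memberships is realized by a point.\<close>

lemma polish_quotient_realizes_patterns:
  fixes C :: "nat \<Rightarrow> 'a set"
  assumes G: "polish_quotient_map \<mu> \<pi> T" and fin: "finite_measure \<mu>"
    and C: "range C \<subseteq> sets \<mu>" and "0 < e"
  shows "\<exists>Z\<in>sets \<mu>. emeasure \<mu> (space \<mu> - Z) \<le> ennreal e \<and>
     (\<forall>\<sigma>. (\<forall>j. \<exists>x\<in>Z. \<forall>i\<le>j. x \<in> C i \<longleftrightarrow> \<sigma> i) \<longrightarrow> (\<exists>x\<in>space \<mu>. \<forall>i. x \<in> C i \<longleftrightarrow> \<sigma> i))"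
proof -
  interpret finite_measure \<mu> by fact
  have T: "polish_topology T" and surj: "\<pi> ` space \<mu> = topspace T"
    and sets_G: "sets \<mu> = {\<pi> -` B \<inter> space \<mu> | B. B \<in> sets (borel_of_topology T)}"
    using G unfolding polish_quotient_map_def by - (elim conjE, assumption)+
  let ?\<nu> = "distr \<mu> (borel_of_topology T) \<pi>"
  have space_T: "space (borel_of_topology T) = topspace T"
    by (simp add: borel_of_topology_def space_measure_of_conv)
  have \<pi>: "\<pi> \<in> \<mu> \<rightarrow>\<^sub>M borel_of_topology T"
  proof (rule measurableI)
    show "\<pi> x \<in> space (borel_of_topology T)" if "x \<in> space \<mu>" for x
      using that surj by (auto simp: space_T)
    show "\<pi> -` B \<inter> space \<mu> \<in> sets \<mu>" if "B \<in> sets (borel_of_topology T)" for B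
      unfolding sets_G using that by blast
  qed
  have fin\<nu>: "finite_measure ?\<nu>" by (rule finite_measure_distr[OF \<pi>])
  have "\<forall>n. \<exists>B. B \<in> sets (borel_of_topology T) \<and> C n = \<pi> -` B \<inter> space \<mu>"
    using C unfolding sets_G by blast
  then obtain B where B: "\<And>n. B n \<in> sets (borel_of_topology T)" "\<And>n. C n = \<pi> -` B n \<inter> space \<mu>"
    by metis
  have "\<forall>n. \<exists>K L. compactin T K \<and> closedin T K \<and> compactin T L \<and> closedin T L \<and> K \<subseteq> B n \<and>
           L \<subseteq> topspace T - B n \<and> emeasure ?\<nu> (topspace T - (K \<union> L)) < ennreal (e / 2 ^ Suc n)"
    using \<open>0 < e\<close> B(1) by (intro allI compact_regular_of_polish[OF T fin\<nu>]) auto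
  then obtain K L where KL: "\<And>n. compactin T (K n)" "\<And>n. closedin T (K n)" "\<And>n. compactin T (L n)"
    "\<And>n. closedin T (L n)" "\<And>n. K n \<subseteq> B n" "\<And>n. L n \<subseteq> topspace T - B n"
    "\<And>n. emeasure ?\<nu> (topspace T - (K n \<union> L n)) < ennreal (e / 2 ^ Suc n)"
    by metis
  have op: "topspace T - (K n \<union> L n) \<in> sets (borel_of_topology T)" for n
  proof -
    have "openin T (topspace T - (K n \<union> L n))" by (simp add: KL openin_diff closedin_Un)
    then show ?thesis by (auto simp: sets_borel_of_topology)
  qed
  \<comment> \<open>The points that the compact approximations of \<open>C n\<close> leave
    undecided. Off \<open>W n\<close>, membership in \<open>C n\<close> can be read off from whether
    the image lies in \<open>K n\<close> or in \<open>L n\<close>.\<close>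
  define W where "W n = \<pi> -` (topspace T - (K n \<union> L n)) \<inter> space \<mu>" for n
  have W: "W n \<in> sets \<mu>" "emeasure \<mu> (W n) < ennreal (e / 2 ^ Suc n)" for n
    using KL(7)[of n] op[of n] \<pi> by (simp_all add: W_def emeasure_distr measurable_sets)
  define Z where "Z = space \<mu> - (\<Union>n. W n)"
  have "Z \<in> sets \<mu>" using W by (auto simp: Z_def)
  moreover have "emeasure \<mu> (space \<mu> - Z) \<le> ennreal e"
  proof -
    have "space \<mu> - Z = (\<Union>n. W n)" using sets.sets_into_space[OF W(1)] by (auto simp: Z_def)
    then show ?thesis using emeasure_UN_less_geometric[of W \<mu> e] W \<open>0 < e\<close> by auto
  qed
  moreover have "\<exists>x\<in>space \<mu>. \<forall>i. x \<in> C i \<longleftrightarrow> \<sigma> i"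
    if \<sigma>: "\<forall>j. \<exists>x\<in>Z. \<forall>i\<le>j. x \<in> C i \<longleftrightarrow> \<sigma> i" for \<sigma>
  proof -
    define E where "E i = (if \<sigma> i then K i else L i)" for i
    have inE: "\<pi> x \<in> E i" if "x \<in> Z" "x \<in> C i \<longleftrightarrow> \<sigma> i" for x i
    proof -
      have "x \<in> space \<mu>" "x \<notin> W i" using that(1) by (auto simp: Z_def)
      then have "\<pi> x \<in> K i \<union> L i" "x \<in> C i \<longleftrightarrow> \<pi> x \<in> B i" using surj by (auto simp: W_def B)
      then show ?thesis using KL(5,6)[of i] that(2) by (auto simp: E_def)
    qed
    \<comment> \<open>Finitely many \<open>E i\<close> meet, since some point of \<open>Z\<close>
      follows \<open>\<sigma>\<close> up to the largest index involved. Compactness of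
      \<open>E 0\<close> and closedness of the others then give a point common to all of
      them.\<close>
    have "E 0 \<inter> \<Inter> (range E) \<noteq> {}"
    proof -
      have "compactin T (E 0)" by (simp add: E_def KL)
      moreover have "\<forall>C\<in>range E. closedin T C" using KL(2,4) by (auto simp: E_def)
      moreover have "E 0 \<inter> \<Inter> \<F> \<noteq> {}" if \<F>: "finite \<F>" "\<F> \<subseteq> range E" for \<F>
      proof -
        obtain I where I: "finite I" "\<F> = E ` I" using finite_subset_image[OF \<F>] by blast
        obtain x where x: "x \<in> Z" "\<forall>i\<le>Max (insert 0 I). x \<in> C i \<longleftrightarrow> \<sigma> i" using \<sigma> by blast
        have "\<pi> x \<in> E i" if "i \<in> insert 0 I" for i
          using x I that by (intro inE) auto
        then show ?thesis using I by auto
      qed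
      ultimately show ?thesis unfolding compactin_fip by blast
    qed
    then obtain y where y: "\<And>i. y \<in> E i" by auto
    then have "y \<in> topspace T" using KL(2,4)[of 0] closedin_subset y[of 0]
      by (metis E_def subsetD)
    then obtain x where x: "x \<in> space \<mu>" "\<pi> x = y" using surj by (metis imageE)
    have "x \<in> C i \<longleftrightarrow> \<sigma> i" for i
      using x y[of i] KL(5,6)[of i] by (auto simp: E_def B split: if_splits)
    then show ?thesis using x by blast
  qed
  ultimately show ?thesis
    by (intro bexI[of _ Z] conjI allI impI)
qed

subsection \<open>Extension of consistent families of measures\<close>

text \<open>Koenig's lemma in disguise. If a set meets every \<open>L k\<close>, so does one of its
  two halves with respect to \<open>D i\<close>: otherwise one half misses some \<open>L k\<close>
  and the other some \<open>L l\<close>, and then the whole set misses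
  \<open>L (max k l)\<close>.\<close>

lemma consistent_signs_exist:
  fixes L :: "nat \<Rightarrow> 'a set" and D :: "nat \<Rightarrow> 'a set"
  assumes "decseq L" "\<And>k. L k \<noteq> {}"
  shows "\<exists>\<sigma>. \<forall>j k. \<exists>x\<in>L k. \<forall>i\<le>j. x \<in> D i \<longleftrightarrow> \<sigma> i"
proof -
  have split: "(\<forall>k. L k \<inter> S \<inter> D i \<noteq> {}) \<or> (\<forall>k. L k \<inter> S \<inter> - D i \<noteq> {})"
    if S: "\<forall>k. L k \<inter> S \<noteq> {}" for S i
  proof (rule ccontr)
    assume "\<not> ?thesis"
    then obtain k l where kl: "L k \<inter> S \<inter> D i = {}" "L l \<inter> S \<inter> - D i = {}" by auto
    have "L (max k l) \<subseteq> L k" "L (max k l) \<subseteq> L l"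
      using assms(1) by (auto simp: decseq_def)
    with kl have "L (max k l) \<inter> S = {}" by blast
    then show False using S by blast
  qed
  \<comment> \<open>\<open>f n\<close> holds the current cell and the sign by which it was last cut.
    The sign for \<open>D n\<close> is therefore stored in \<open>f (Suc n)\<close>.\<close>
  have "\<exists>f. \<forall>n. (\<forall>k. L k \<inter> fst (f n) \<noteq> {}) \<and>
      (fst (f (Suc n)) \<subseteq> fst (f n) \<inter> (if snd (f (Suc n)) then D n else - D n))"
  proof (rule dependent_nat_choice)
    show "\<exists>x :: 'a set \<times> bool. \<forall>k. L k \<inter> fst x \<noteq> {}"
      using assms(2) by (intro exI[of _ "(UNIV, True)"]) auto
    show "\<exists>y :: 'a set \<times> bool. (\<forall>k. L k \<inter> fst y \<noteq> {}) \<and> fst y \<subseteq> fst x \<inter> (if snd y then D n else - D n)"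
      if "\<forall>k. L k \<inter> fst x \<noteq> {}" for x :: "'a set \<times> bool" and n
      using split[OF that, of n]
    proof
      assume "\<forall>k. L k \<inter> fst x \<inter> D n \<noteq> {}"
      then show ?thesis by (intro exI[of _ "(fst x \<inter> D n, True)"]) (auto simp: Int_assoc)
    next
      assume "\<forall>k. L k \<inter> fst x \<inter> - D n \<noteq> {}"
      then show ?thesis by (intro exI[of _ "(fst x \<inter> - D n, False)"]) (auto simp: Int_assoc)
    qed
  qed
  then obtain f where f: "\<And>n k. L k \<inter> fst (f n) \<noteq> {}"
    "\<And>n. fst (f (Suc n)) \<subseteq> fst (f n) \<inter> (if snd (f (Suc n)) then D n else - D n)"
    by blast
  have dec: "decseq (\<lambda>n. fst (f n))"
    using f(2) by (intro decseq_SucI) blast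
  have "\<exists>x\<in>L k. \<forall>i\<le>j. x \<in> D i \<longleftrightarrow> snd (f (Suc i))" for j k
  proof -
    obtain x where x: "x \<in> L k" "x \<in> fst (f (Suc j))" using f(1)[of k "Suc j"] by auto
    have "x \<in> D i \<longleftrightarrow> snd (f (Suc i))" if "i \<le> j" for i
    proof -
      have "x \<in> fst (f (Suc i))" using x(2) decseqD[OF dec, of "Suc i" "Suc j"] that by auto
      then show ?thesis using f(2)[of i] by (auto split: if_splits)
    qed
    then show ?thesis using x by blast
  qed
  then show ?thesis by (intro exI[of _ "\<lambda>i. snd (f (Suc i))"]) blast
qed

text \<open>Caratheodory's theorem on the union of the sigma-algebras; the point is continuity at
  the empty set. If a decreasing sequence of sets keeps mass above some positive number, then one
  consistent pattern of signs can be realized at every level separately, and the hypothesis on atoms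
  turns these realizations into one point in all sets of the sequence.\<close>

lemma projective_family_extension:
  fixes \<mu> :: "nat \<Rightarrow> 'a measure"
  assumes space: "\<And>n. space (\<mu> n) = \<Omega>"
    and fin: "\<And>n. finite_measure (\<mu> n)"
    and mono: "\<And>n. sets (\<mu> n) \<subseteq> sets (\<mu> (Suc n))"
    and consistent: "\<And>n B. B \<in> sets (\<mu> n) \<Longrightarrow> emeasure (\<mu> (Suc n)) B = emeasure (\<mu> n) B"
    and countably_generated:
      "\<And>n. \<exists>C. countable C \<and> C \<subseteq> Pow \<Omega> \<and> sets (\<mu> n) = sigma_sets \<Omega> C"
    and polish: "\<And>n. \<exists>(\<pi> :: 'a \<Rightarrow> 'b) T. polish_quotient_map (\<mu> n) \<pi> T"
    and atoms: "\<And>\<omega> :: nat \<Rightarrow> 'a. range \<omega> \<subseteq> \<Omega> \<Longrightarrow>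
      (\<And>N. (\<Inter>n\<le>N. atom_of (\<mu> n) (\<omega> n)) \<noteq> {}) \<Longrightarrow> (\<Inter>n. atom_of (\<mu> n) (\<omega> n)) \<noteq> {}"
  shows "\<exists>\<nu>. space \<nu> = \<Omega> \<and> sets \<nu> = sigma_sets \<Omega> (\<Union>n. sets (\<mu> n)) \<and>
    (\<forall>n. \<forall>B\<in>sets (\<mu> n). emeasure \<nu> B = emeasure (\<mu> n) B)"
proof -
  have mono': "sets (\<mu> m) \<subseteq> sets (\<mu> n)" if "m \<le> n" for m n
    using lift_Suc_mono_le[of "\<lambda>n. sets (\<mu> n)", OF mono that] .
  have cons: "emeasure (\<mu> n) B = emeasure (\<mu> m) B" if "m \<le> n" "B \<in> sets (\<mu> m)" for m n B
    using that
  proof (induction n rule: dec_induct)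
    case (step n)
    then have "B \<in> sets (\<mu> n)" using mono'[of m n] by auto
    then show ?case using consistent[of B n] step by simp
  qed simp
  define \<A> where "\<A> = (\<Union>n. sets (\<mu> n))"
  define f where "f B = emeasure (\<mu> (LEAST n. B \<in> sets (\<mu> n))) B" for B
  have f: "f B = emeasure (\<mu> n) B" if "B \<in> sets (\<mu> n)" for n B
    unfolding f_def
    by (rule cons[symmetric]) (rule Least_le LeastI[where P = "\<lambda>n. B \<in> sets (\<mu> n)"], fact)+
  have two: "\<exists>n. A \<in> sets (\<mu> n) \<and> B \<in> sets (\<mu> n)" if AB: "A \<in> \<A>" "B \<in> \<A>" for A B
  proof -
    obtain m n where "A \<in> sets (\<mu> m)" "B \<in> sets (\<mu> n)" using AB unfolding \<A>_def by blast
    then show ?thesis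
      using mono'[of m "max m n"] mono'[of n "max m n"] by (intro exI[of _ "max m n"]) auto
  qed
  have "algebra \<Omega> \<A>"
    unfolding algebra_iff_Un
  proof (intro conjI ballI)
    show "\<A> \<subseteq> Pow \<Omega>" using sets.sets_into_space space by (fastforce simp: \<A>_def)
    show "{} \<in> \<A>" by (auto simp: \<A>_def)
    show "\<Omega> - A \<in> \<A>" if "A \<in> \<A>" for A
      using that sets.compl_sets space by (fastforce simp: \<A>_def)
    show "A \<union> B \<in> \<A>" if "A \<in> \<A>" "B \<in> \<A>" for A B
      using two[OF that] by (auto simp: \<A>_def)
  qed
  then interpret algebra \<Omega> \<A> .
  have "\<exists>\<rho> :: 'a set \<Rightarrow> ennreal. (\<forall>s\<in>\<A>. \<rho> s = f s) \<and> measure_space \<Omega> (sigma_sets \<Omega> \<A>) \<rho>"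
  proof (rule caratheodory_empty_continuous)
    show "positive \<A> f" by (simp add: positive_def f[of "{}" 0])
    show "additive \<A> f"
      unfolding additive_def
    proof (intro ballI impI)
      fix A B assume AB: "A \<in> \<A>" "B \<in> \<A>" "A \<inter> B = {}"
      obtain n where "A \<in> sets (\<mu> n)" "B \<in> sets (\<mu> n)" using two AB by blast
      then show "f (A \<union> B) = f A + f B"
        using AB f[of _ n] by (simp add: plus_emeasure)
    qed
    show "f A \<noteq> \<infinity>" if "A \<in> \<A>" for A
      using that f finite_measure.emeasure_finite[OF fin] by (auto simp: \<A>_def)
    fix A :: "nat \<Rightarrow> 'a set"
    assume A: "range A \<subseteq> \<A>" "decseq A" "(\<Inter>i. A i) = {}"
    have f_mono: "f B \<le> f C" if "B \<in> \<A>" "C \<in> \<A>" "B \<subseteq> C" for B C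
      using two[OF that(1,2)] f that(3) by (metis emeasure_mono)
    have dec: "decseq (\<lambda>i. f (A i))"
      using A by (intro decseq_SucI f_mono) (auto simp: decseq_def)
    show "(\<lambda>i. f (A i)) \<longlonglongrightarrow> 0"
    proof (rule ccontr)
      assume "\<not> ?thesis"
      then have "(INF i. f (A i)) \<noteq> 0" using LIMSEQ_INF[OF dec] by metis
      then have "0 < (INF i. f (A i))" by (simp add: zero_less_iff_neq_zero)
      then obtain y where y: "0 < y" "y < (INF i. f (A i))" using dense by blast
      define \<epsilon> where "\<epsilon> = enn2real y"
      have "y < top" using y(2) by (metis less_trans not_less_iff_gr_or_eq top.not_eq_extremum)
      then have \<epsilon>: "0 < \<epsilon>" "ennreal \<epsilon> < (INF i. f (A i))"
        using y by (simp_all add: \<epsilon>_def enn2real_positive_iff)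
      then have fA: "ennreal \<epsilon> < f (A i)" for i
        by (meson INF_lower UNIV_I less_le_trans)
      have "\<forall>n. \<exists>C. countable C \<and> C \<subseteq> Pow \<Omega> \<and> sets (\<mu> n) = sigma_sets \<Omega> C"
        using countably_generated by blast
      from choice[OF this] obtain C where
        C': "\<forall>n. countable (C n) \<and> C n \<subseteq> Pow \<Omega> \<and> sets (\<mu> n) = sigma_sets \<Omega> (C n)" ..
      have C: "countable (C n)" "C n \<subseteq> Pow \<Omega>" "sets (\<mu> n) = sigma_sets \<Omega> (C n)" for n
        using C'[THEN spec, of n] by - (elim conjE, assumption)+
      \<comment> \<open>The pattern has to record the generators of all levels, which determine the
        atoms, and the sets \<open>A k\<close>, in whose intersection a point is wanted.\<close>
      define \<D> where "\<D> = (\<Union>n. C n) \<union> range A"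
      have "countable \<D>" "\<D> \<noteq> {}" using C by (auto simp: \<D>_def)
      define D where "D = from_nat_into \<D>"
      have D: "\<D> = range D"
        unfolding D_def using range_from_nat_into[OF \<open>\<D> \<noteq> {}\<close> \<open>countable \<D>\<close>] by (rule sym)
      \<comment> \<open>Level \<open>n\<close> can only approximate sets measurable there. The
        others are replaced by the empty set, so that the enumeration of \<open>\<D>\<close> is the
        same at all levels.\<close>
      define D' where "D' n i = (if D i \<in> sets (\<mu> n) then D i else {})" for n i
      have "\<exists>Z\<in>sets (\<mu> n). emeasure (\<mu> n) (\<Omega> - Z) \<le> ennreal (\<epsilon> / 2 ^ Suc n) \<and>
         (\<forall>\<sigma>. (\<forall>j. \<exists>x\<in>Z. \<forall>i\<le>j. x \<in> D' n i \<longleftrightarrow> \<sigma> i) \<longrightarrow>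
            (\<exists>x\<in>\<Omega>. \<forall>i. x \<in> D' n i \<longleftrightarrow> \<sigma> i))" for n
      proof -
        obtain \<pi> :: "'a \<Rightarrow> 'b" and T where "polish_quotient_map (\<mu> n) \<pi> T" using polish by blast
        moreover have "range (D' n) \<subseteq> sets (\<mu> n)" by (auto simp: D'_def)
        ultimately show ?thesis
          using polish_quotient_realizes_patterns[OF _ fin, of n \<pi> T "D' n" "\<epsilon> / 2 ^ Suc n"] \<epsilon>(1)
          unfolding space by simp
      qed
      then obtain Z where Z: "\<And>n. Z n \<in> sets (\<mu> n)"
        "\<And>n. emeasure (\<mu> n) (\<Omega> - Z n) \<le> ennreal (\<epsilon> / 2 ^ Suc n)"
        "\<And>n \<sigma>. (\<And>j. \<exists>x\<in>Z n. \<forall>i\<le>j. x \<in> D' n i \<longleftrightarrow> \<sigma> i) \<Longrightarrow>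
            \<exists>x\<in>\<Omega>. \<forall>i. x \<in> D' n i \<longleftrightarrow> \<sigma> i"
        unfolding bchoice_iff Bex_def by metis
      \<comment> \<open>What remains of \<open>A k\<close> after discarding the exceptional sets of
        the levels up to \<open>k\<close>. They have total mass at most \<open>\<epsilon>\<close>,
        which is strictly less than \<open>f (A k)\<close>, so something does remain.\<close>
      define L where "L k = A k \<inter> (\<Inter>n\<le>k. Z n)" for k
      have "decseq L"
        using A(2) by (fastforce simp: L_def decseq_def)
      moreover have "L k \<noteq> {}" for k
      proof
        assume "L k = {}"
        obtain m where m: "A k \<in> sets (\<mu> m)" using A(1) unfolding \<A>_def by blast
        define r where "r = max m k"
        have r: "A k \<in> sets (\<mu> r)" "\<And>n. n \<le> k \<Longrightarrow> Z n \<in> sets (\<mu> r)"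
          by (rule mono'[THEN subsetD, OF _ m] mono'[THEN subsetD, OF _ Z(1)], simp add: r_def)+
        have sp: "\<Omega> \<in> sets (\<mu> n)" for n using sets.top[of "\<mu> n"] by (simp add: space)
        have "A k \<subseteq> \<Omega>" using sets.sets_into_space[OF r(1)] by (simp add: space)
        then have "A k \<subseteq> (\<Union>n\<le>k. \<Omega> - Z n)" using \<open>L k = {}\<close> by (auto simp: L_def)
        have "f (A k) = emeasure (\<mu> r) (A k)" using f r by simp
        also have "\<dots> \<le> emeasure (\<mu> r) (\<Union>n\<le>k. \<Omega> - Z n)"
          using \<open>A k \<subseteq> (\<Union>n\<le>k. \<Omega> - Z n)\<close> r sp by (intro emeasure_mono sets.finite_UN) auto
        also have "\<dots> \<le> (\<Sum>n\<le>k. emeasure (\<mu> r) (\<Omega> - Z n))"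
          using r sp by (intro emeasure_subadditive_finite) auto
        also have "\<dots> = (\<Sum>n\<le>k. emeasure (\<mu> n) (\<Omega> - Z n))"
          using Z(1) sp by (intro sum.cong refl cons) (auto simp: r_def)
        also have "\<dots> \<le> (\<Sum>n\<le>k. ennreal (\<epsilon> / 2 ^ Suc n))"
          by (intro sum_mono Z(2))
        also have "\<dots> \<le> (\<Sum>n. ennreal (\<epsilon> / 2 ^ Suc n))"
          by (rule sum_le_suminf) simp_all
        also have "\<dots> = ennreal \<epsilon>" using \<epsilon> by (intro suminf_ennreal_geometric) simp
        finally show False using fA[of k] by simp
      qed
      ultimately obtain \<sigma> where \<sigma>: "\<And>j k. \<exists>x\<in>L k. \<forall>i\<le>j. x \<in> D i \<longleftrightarrow> \<sigma> i"
        using consistent_signs_exist[of L D] by blast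
      have "\<exists>x\<in>\<Omega>. \<forall>i. D i \<in> sets (\<mu> n) \<longrightarrow> (x \<in> D i \<longleftrightarrow> \<sigma> i)" for n
      proof -
        have "\<exists>x\<in>\<Omega>. \<forall>i. x \<in> D' n i \<longleftrightarrow> \<sigma> i \<and> D i \<in> sets (\<mu> n)"
        proof (rule Z(3))
          fix j
          obtain x where "x \<in> L n" "\<forall>i\<le>j. x \<in> D i \<longleftrightarrow> \<sigma> i" using \<sigma> by blast
          then show "\<exists>x\<in>Z n. \<forall>i\<le>j. x \<in> D' n i \<longleftrightarrow> \<sigma> i \<and> D i \<in> sets (\<mu> n)"
            by (intro bexI[of _ x]) (auto simp: D'_def L_def)
        qed
        then obtain x where x: "x \<in> \<Omega>" "\<forall>i. x \<in> D' n i \<longleftrightarrow> \<sigma> i \<and> D i \<in> sets (\<mu> n)" by blast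
        have "x \<in> D i \<longleftrightarrow> \<sigma> i" if "D i \<in> sets (\<mu> n)" for i
          using x(2)[THEN spec, of i] that by (simp add: D'_def)
        then show ?thesis using x(1) by blast
      qed
      then obtain x where x: "\<And>n. x n \<in> \<Omega>" "\<And>n i. D i \<in> sets (\<mu> n) \<Longrightarrow> x n \<in> D i \<longleftrightarrow> \<sigma> i"
        by metis
      \<comment> \<open>A generator of level \<open>n\<close> is measurable at level
        \<open>N\<close> as well, so \<open>x n\<close> and \<open>x N\<close> both follow
        \<open>\<sigma>\<close> on it. Thus \<open>x N\<close> itself witnesses that the first atoms
        up to \<open>N\<close> intersect.\<close>
      have "x N \<in> atom_of (\<mu> n) (x n)" if "n \<le> N" for n N
      proof (rule atom_of_memI[OF C(3,2) x(1) x(1)])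
        fix B assume B: "B \<in> C n"
        then have "B \<in> \<D>" by (auto simp: \<D>_def)
        then obtain i where i: "B = D i" using D by auto
        have "B \<in> sets (\<mu> n)" using B C(3) by auto
        then show "x n \<in> B \<longleftrightarrow> x N \<in> B"
          using x(2)[of i n] x(2)[of i N] mono'[OF that] i by auto
      qed
      then have "x N \<in> (\<Inter>n\<le>N. atom_of (\<mu> n) (x n))" for N by simp
      then have "(\<Inter>n\<le>N. atom_of (\<mu> n) (x n)) \<noteq> {}" for N by (metis empty_iff)
      then have "(\<Inter>n. atom_of (\<mu> n) (x n)) \<noteq> {}"
        by (intro atoms) (use x(1) in auto)
      then obtain \<omega> where "\<omega> \<in> (\<Inter>n. atom_of (\<mu> n) (x n))"
        unfolding ex_in_conv[symmetric] ..
      then have \<omega>: "\<omega> \<in> atom_of (\<mu> n) (x n)" for n by (rule INT_D) simp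
      \<comment> \<open>The pattern assigns the sign True to \<open>A k\<close>, because it is
        realized inside \<open>L k\<close>, a subset of \<open>A k\<close>. At a level where
        \<open>A k\<close> is measurable, \<open>\<omega>\<close> lies in the atom of a point that
        follows the pattern.\<close>
      have "\<omega> \<in> A k" for k
      proof -
        have "A k \<in> \<D>" by (auto simp: \<D>_def)
        then obtain i where i: "A k = D i" using D by auto
        obtain y where "y \<in> L k" "y \<in> D i \<longleftrightarrow> \<sigma> i" using \<sigma>[of k i] by blast
        then have "\<sigma> i" using i by (auto simp: L_def)
        moreover obtain n where n: "A k \<in> sets (\<mu> n)" using A(1) unfolding \<A>_def by blast
        ultimately have "x n \<in> A k" using x(2)[of i n] i by simp
        then show ?thesis using \<omega>[of n] n by (auto simp: atom_of_def)
      qed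
      then show False using A(3) by blast
    qed
  qed
  then obtain \<rho> :: "'a set \<Rightarrow> ennreal"
    where \<rho>: "\<And>s. s \<in> \<A> \<Longrightarrow> \<rho> s = f s" "measure_space \<Omega> (sigma_sets \<Omega> \<A>) \<rho>"
    by blast
  show ?thesis
  proof (intro exI[of _ "measure_of \<Omega> \<A> \<rho>"] conjI allI ballI)
    show "space (measure_of \<Omega> \<A> \<rho>) = \<Omega>" using space_closed by (rule space_measure_of)
    show "sets (measure_of \<Omega> \<A> \<rho>) = sigma_sets \<Omega> (\<Union>n. sets (\<mu> n))"
      unfolding \<A>_def[symmetric] using space_closed by (rule sets_measure_of)
    fix n B assume B: "B \<in> sets (\<mu> n)"
    then have "B \<in> \<A>" by (auto simp: \<A>_def)
    then have "emeasure (measure_of \<Omega> \<A> \<rho>) B = \<rho> B"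
      using \<rho>(2) by (auto simp: emeasure_measure_of_conv)
    then show "emeasure (measure_of \<Omega> \<A> \<rho>) B = emeasure (\<mu> n) B"
      using \<rho>(1) \<open>B \<in> \<A>\<close> f[OF B] by simp
  qed
qed

subsection \<open>Flat periods of the increasing process\<close>

text \<open>Zeros of \<open>x\<close> accumulate at \<open>\<sigma>\<close> from the right, while a
  positive value would persist for a while by right-continuity.\<close>

lemma eq_zero_before_increase:
  fixes x :: "real \<Rightarrow> real"
  assumes x: "(x \<longlongrightarrow> x \<sigma>) (at_right \<sigma>)" "0 \<le> x \<sigma>" and "\<sigma> < r"
    and inc: "\<And>v. \<sigma> < v \<Longrightarrow> v \<le> r \<Longrightarrow> \<exists>w. \<sigma> < w \<and> w \<le> v \<and> x w = 0"
  shows "x \<sigma> = 0"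
proof (rule ccontr)
  assume "x \<sigma> \<noteq> 0"
  then have "0 < x \<sigma>" using x by simp
  from order_tendstoD(1)[OF x(1) this] obtain b where b: "\<sigma> < b" "\<And>v. \<sigma> < v \<Longrightarrow> v < b \<Longrightarrow> 0 < x v"
    by (auto simp: eventually_at_right_field)
  obtain c where c: "\<sigma> < c" "c < b" using dense[OF b(1)] by blast
  from inc[of "min c r"] \<open>\<sigma> < r\<close> c(1) obtain w where "\<sigma> < w" "w \<le> c" "x w = 0" by auto
  then show False using b(2)[of w] c(2) by simp
qed

text \<open>The summand with index \<open>i\<close> is present only if \<open>a\<close> first leaves its value at \<open>s\<close> in the \<open>i\<close>-th
  interval of the grid. The right end of that interval tends from the right to the last time \<open>\<sigma>\<close>
  with \<open>a \<sigma> = a s\<close>, which is an accumulation point of zeros of \<open>x\<close>.\<close>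

lemma first_increase_sum_tendsto_0:
  fixes a x :: "real \<Rightarrow> real" and s r K :: real
  defines "u \<equiv> \<lambda>n i. s + (r - s) * real i / real (Suc n)"
  assumes "0 \<le> s" "s \<le> r" "0 \<le> K"
    and a: "continuous_on {0..} a" "mono_on {0..} a"
    and x: "\<And>t. 0 \<le> t \<Longrightarrow> (x \<longlongrightarrow> x t) (at_right t)" "\<And>t. 0 \<le> t \<Longrightarrow> 0 \<le> x t"
    and zeros: "\<And>t v. 0 \<le> t \<Longrightarrow> a t < a v \<Longrightarrow> t < v \<Longrightarrow> \<exists>w. t < w \<and> w \<le> v \<and> x w = 0"
  shows "(\<lambda>n. \<Sum>i<Suc n. (of_bool (a (u n i) = a s) - of_bool (a (u n (Suc i)) = a s)) *
            (min (x (u n (Suc i))) K + (a (u n (Suc i)) - a s))) \<longlonglongrightarrow> 0"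
proof -
  have u: "s \<le> u n i" "i \<le> Suc n \<Longrightarrow> u n i \<le> r" "i \<le> j \<Longrightarrow> u n i \<le> u n j"
     "u n 0 = s" "u n (Suc n) = r" "u n (Suc i) = u n i + (r - s) / real (Suc n)" for n i j
  proof -
    show "s \<le> u n i" using assms by (simp add: u_def)
    show *: "i \<le> j \<Longrightarrow> u n i \<le> u n j" for i j
      using assms(3) by (simp add: u_def divide_right_mono mult_left_mono)
    show r: "u n (Suc n) = r" by (simp add: u_def)
    show "i \<le> Suc n \<Longrightarrow> u n i \<le> r" using *[of i "Suc n"] r by simp
    show "u n 0 = s" by (simp add: u_def)
    show "u n (Suc i) = u n i + (r - s) / real (Suc n)"
    proof -
      have "u n (Suc i) = s + ((r - s) * real i + (r - s)) / real (Suc n)"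
        by (simp add: u_def distrib_left add.commute)
      then show ?thesis by (simp only: u_def add_divide_distrib add.assoc)
    qed
  qed
  have mono: "a v \<le> a w" if "0 \<le> v" "v \<le> w" for v w
    using a(2) that by (auto simp: mono_on_def)
  let ?d = "\<lambda>n i. of_bool (a (u n i) = a s) - of_bool (a (u n (Suc i)) = a s) :: real"
  have dichotomy: "?d n i = 0 \<or> (?d n i = 1 \<and> a (u n i) = a s \<and> a s < a (u n (Suc i)))" for n i
  proof -
    have "a s \<le> a (u n i)" "a (u n i) \<le> a (u n (Suc i))"
      using u(1)[of n i] u(3)[of i "Suc i" n] \<open>0 \<le> s\<close> by (auto intro!: mono)
    then show ?thesis by auto
  qed
  \<comment> \<open>The weights are 0 or 1 and telescope, so at most one cell is active, namely the
    one in which \<open>a\<close> first leaves the value \<open>a s\<close>.\<close>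
  have sum_d: "(\<Sum>i<Suc n. ?d n i) = 1 - of_bool (a r = a s)" for n
    using sum_lessThan_telescope'[of "\<lambda>i. of_bool (a (u n i) = a s) :: real" "Suc n"]
    by (simp only: u(4,5)) simp
  show ?thesis
  proof (cases "a r = a s")
    case True
    have "?d n i = 0" if "i < Suc n" for n i
    proof -
      have "a (u n (Suc i)) \<le> a s"
        using u(1)[of n "Suc i"] u(2)[of "Suc i" n] that True \<open>0 \<le> s\<close> mono[of "u n (Suc i)" r] by simp
      then show ?thesis using dichotomy[of n i] by auto
    qed
    then show ?thesis by simp
  next
    case False
    then have ar: "a s < a r" "s < r"
      using mono[of s r] assms(2,3) by (auto simp: less_le)
    \<comment> \<open>By continuity the flat times form a compact set; its maximum
      \<open>\<sigma>\<close> is the last time before \<open>a\<close> increases.\<close>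
    define L where "L = {v \<in> {s..r}. a v = a s}"
    have "closed L"
      unfolding L_def using assms(2)
      by (intro continuous_closed_preimage_constant continuous_on_subset[OF a(1)]) auto
    moreover have "bounded L" by (rule bounded_subset[of "{s..r}"]) (auto simp: L_def)
    ultimately have "compact L" by (simp add: compact_eq_bounded_closed)
    moreover have "s \<in> L" using assms by (simp add: L_def)
    ultimately obtain \<sigma> where \<sigma>: "\<sigma> \<in> L" "\<And>v. v \<in> L \<Longrightarrow> v \<le> \<sigma>"
      using compact_attains_sup[of L] by auto
    have "0 \<le> \<sigma>" "a \<sigma> = a s" "s \<le> \<sigma>" "\<sigma> \<le> r" using \<sigma>(1) assms by (auto simp: L_def)
    then have "\<sigma> < r" using ar by (auto simp: less_le)
    have after: "a s < a v" if "\<sigma> < v" "v \<le> r" for v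
      using \<sigma>(2)[of v] mono[of \<sigma> v] that \<open>0 \<le> \<sigma>\<close> \<open>a \<sigma> = a s\<close> \<open>s \<le> \<sigma>\<close>
      by (fastforce simp: L_def less_le)
    have "x \<sigma> = 0"
      using x[of \<sigma>] \<open>0 \<le> \<sigma>\<close> \<open>\<sigma> < r\<close> zeros[of \<sigma>] after \<open>a \<sigma> = a s\<close>
      by (intro eq_zero_before_increase[of x \<sigma> r]) auto
    have "(a \<longlongrightarrow> a \<sigma>) (at \<sigma> within {0..})"
      using a(1) \<open>0 \<le> \<sigma>\<close> by (auto simp: continuous_on_def)
    then have "(a \<longlongrightarrow> a \<sigma>) (at_right \<sigma>)"
      by (rule tendsto_within_subset) (use \<open>0 \<le> \<sigma>\<close> in auto)
    then have "((\<lambda>v. min (x v) K + (a v - a s)) \<longlongrightarrow> min (x \<sigma>) K + (a \<sigma> - a s)) (at_right \<sigma>)"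
      using x(1)[OF \<open>0 \<le> \<sigma>\<close>] by (intro tendsto_intros)
    then have lim: "((\<lambda>v. min (x v) K + (a v - a s)) \<longlongrightarrow> 0) (at_right \<sigma>)"
      using \<open>x \<sigma> = 0\<close> \<open>0 \<le> K\<close> \<open>a \<sigma> = a s\<close> by simp
    show ?thesis
    proof (rule LIMSEQ_I)
      fix \<eta> :: real assume "0 < \<eta>"
      then have "eventually (\<lambda>v. min (x v) K + (a v - a s) < \<eta> / 2) (at_right \<sigma>)"
        by (intro order_tendstoD(2)[OF lim]) simp
      then obtain b where b: "\<sigma> < b" "\<And>v. \<sigma> < v \<Longrightarrow> v < b \<Longrightarrow> min (x v) K + (a v - a s) < \<eta> / 2"
        by (auto simp: eventually_at_right_field)
      have "(\<lambda>n. (r - s) / real (Suc n)) \<longlonglongrightarrow> 0"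
        using tendsto_mult_right_zero[OF LIMSEQ_inverse_real_of_nat, of "r - s"]
        by (simp add: divide_inverse)
      then obtain n0 where n0: "\<And>n. n \<ge> n0 \<Longrightarrow> (r - s) / real (Suc n) < b - \<sigma>"
        using order_tendstoD(2)[of _ 0 sequentially "b - \<sigma>"] b(1) by (auto simp: eventually_sequentially)
      \<comment> \<open>The active cell contains \<open>\<sigma>\<close>, and its width is below
        \<open>b - \<sigma>\<close>. So its right end lies strictly between \<open>\<sigma>\<close>
        and \<open>b\<close>, where the summand is already below \<open>\<eta> / 2\<close>.\<close>
      have bound: "0 \<le> ?d n i * (min (x (u n (Suc i))) K + (a (u n (Suc i)) - a s)) \<and>
          ?d n i * (min (x (u n (Suc i))) K + (a (u n (Suc i)) - a s)) \<le> ?d n i * (\<eta> / 2)"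
        if "n \<ge> n0" "i < Suc n" for n i
        using dichotomy[of n i]
      proof (elim disjE conjE)
        assume d: "?d n i = 1" "a (u n i) = a s" "a s < a (u n (Suc i))"
        have "u n i \<in> L" using d u(1,2)[of n i] u(2)[of i n] that by (auto simp: L_def)
        then have 1: "u n i \<le> \<sigma>" by (rule \<sigma>(2))
        have 2: "\<sigma> < u n (Suc i)"
        proof (rule ccontr)
          assume "\<not> \<sigma> < u n (Suc i)"
          then have "a (u n (Suc i)) \<le> a \<sigma>"
            using order_trans[OF assms(2) u(1)[of n "Suc i"]] by (intro mono) simp_all
          then show False using d(3) \<open>a \<sigma> = a s\<close> by simp
        qed
        have "u n (Suc i) < b" using 1 n0[OF that(1)] by (simp add: u(6))
        from b(2)[OF 2 this] x(2)[of "u n (Suc i)"] 2 \<open>0 \<le> \<sigma>\<close> \<open>0 \<le> K\<close> d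
        show ?thesis by simp
      qed simp
      have "norm ((\<Sum>i<Suc n. ?d n i * (min (x (u n (Suc i))) K + (a (u n (Suc i)) - a s))) - 0) < \<eta>"
        if n: "n \<ge> n0" for n
      proof -
        have "(\<Sum>i<Suc n. ?d n i * (min (x (u n (Suc i))) K + (a (u n (Suc i)) - a s)))
            \<le> (\<Sum>i<Suc n. ?d n i * (\<eta> / 2))"
          using bound[OF n] by (intro sum_mono) auto
        also have "\<dots> = \<eta> / 2"
          unfolding sum_distrib_right[symmetric] sum_d using False by simp
        finally have "(\<Sum>i<Suc n. ?d n i * (min (x (u n (Suc i))) K + (a (u n (Suc i)) - a s))) \<le> \<eta> / 2" .
        moreover have "0 \<le> (\<Sum>i<Suc n. ?d n i * (min (x (u n (Suc i))) K + (a (u n (Suc i)) - a s)))"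
          using bound[OF n] by (intro sum_nonneg) auto
        ultimately show ?thesis
          using \<open>0 < \<eta>\<close> unfolding real_norm_def diff_zero by linarith
      qed
      then show "\<exists>no. \<forall>n\<ge>no. norm ((\<Sum>i<Suc n. ?d n i * (min (x (u n (Suc i))) K + (a (u n (Suc i)) - a s))) - 0) < \<eta>"
        by blast
    qed
  qed
qed

text \<open>The form in which the hypotheses are used: the martingale property is tested against
  events instead of being stated with conditional expectations, and the condition on the measure dA
  becomes \<open>zero_between\<close>, a zero of \<open>X\<close> in every half-open interval over
  which \<open>A\<close> increases.\<close>

locale class_Sigma_decomposition = prob_space P
  for P :: "'a measure" and F :: "real \<Rightarrow> 'a measure" and N A X :: "real \<Rightarrow> 'a \<Rightarrow> real" +
  assumes subalg: "0 \<le> t \<Longrightarrow> subalgebra P (F t)"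
    and F_mono: "0 \<le> s \<Longrightarrow> s \<le> t \<Longrightarrow> sets (F s) \<subseteq> sets (F t)"
    and X_adapted: "0 \<le> t \<Longrightarrow> X t \<in> borel_measurable (F t)"
    and A_adapted: "0 \<le> t \<Longrightarrow> A t \<in> borel_measurable (F t)"
    and N_integrable: "0 \<le> t \<Longrightarrow> integrable P (N t)"
    and X_integrable: "0 \<le> t \<Longrightarrow> integrable P (X t)"
    and X_eq: "0 \<le> t \<Longrightarrow> \<omega> \<in> space P \<Longrightarrow> X t \<omega> = N t \<omega> + A t \<omega>"
    and X_nonneg: "0 \<le> t \<Longrightarrow> \<omega> \<in> space P \<Longrightarrow> 0 \<le> X t \<omega>"
    and N_martingale: "0 \<le> s \<Longrightarrow> s \<le> t \<Longrightarrow> B \<in> sets (F s) \<Longrightarrow>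
      (\<integral>\<omega>. indicator B \<omega> * N t \<omega> \<partial>P) = (\<integral>\<omega>. indicator B \<omega> * N s \<omega> \<partial>P)"
    and X_right_cont: "0 \<le> t \<Longrightarrow> \<omega> \<in> space P \<Longrightarrow> ((\<lambda>t. X t \<omega>) \<longlongrightarrow> X t \<omega>) (at_right t)"
    and A_cont: "\<omega> \<in> space P \<Longrightarrow> continuous_on {0..} (\<lambda>t. A t \<omega>)"
    and A_mono_on: "\<omega> \<in> space P \<Longrightarrow> mono_on {0..} (\<lambda>t. A t \<omega>)"
    and zero_between: "\<omega> \<in> space P \<Longrightarrow> 0 \<le> t \<Longrightarrow> A t \<omega> < A v \<omega> \<Longrightarrow> t < v \<Longrightarrow>
      \<exists>w. t < w \<and> w \<le> v \<and> X w \<omega> = 0"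
begin

lemma space_F: "0 \<le> t \<Longrightarrow> space (F t) = space P"
  using subalg[of t] by (simp add: subalgebra_def)

lemma sets_F: "0 \<le> t \<Longrightarrow> B \<in> sets (F t) \<Longrightarrow> B \<in> sets P"
  using subalg[of t] by (auto simp: subalgebra_def)

lemma adapted_mono:
  assumes "0 \<le> s" "s \<le> t" "f \<in> borel_measurable (F s)"
  shows "f \<in> borel_measurable (F t)"
  using assms F_mono[OF assms(1,2)] space_F[of s] space_F[of t]
  by (auto intro: measurable_from_subalg simp: subalgebra_def)

lemma A_mono: "\<omega> \<in> space P \<Longrightarrow> 0 \<le> s \<Longrightarrow> s \<le> t \<Longrightarrow> A s \<omega> \<le> A t \<omega>"
  using A_mono_on[of \<omega>] by (auto simp: mono_on_def)

lemma A_integrable: "0 \<le> t \<Longrightarrow> integrable P (A t)"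
proof -
  assume t: "0 \<le> t"
  then have "integrable P (\<lambda>\<omega>. X t \<omega> - N t \<omega>)"
    by (intro Bochner_Integration.integrable_diff X_integrable N_integrable)
  moreover have "integrable P (\<lambda>\<omega>. X t \<omega> - N t \<omega>) \<longleftrightarrow> integrable P (A t)"
    by (intro Bochner_Integration.integrable_cong) (auto simp: X_eq t)
  ultimately show ?thesis by simp
qed

text \<open>Since \<open>A\<close> increases, equal values at the end points mean that
  \<open>A\<close> is constant on the whole interval.\<close>

definition flat :: "real \<Rightarrow> real \<Rightarrow> 'a set" where
  "flat s t = {\<omega> \<in> space P. A t \<omega> = A s \<omega>}"

lemma flat_sets: "0 \<le> s \<Longrightarrow> s \<le> t \<Longrightarrow> flat s t \<in> sets (F t)"
proof -
  assume st: "0 \<le> s" "s \<le> t"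
  then have [measurable]: "A s \<in> borel_measurable (F t)" "A t \<in> borel_measurable (F t)"
    by (auto intro: adapted_mono A_adapted)
  have "{\<omega> \<in> space (F t). A t \<omega> = A s \<omega>} \<in> sets (F t)" by measurable
  then show ?thesis using st by (simp add: flat_def space_F)
qed

lemma flat_split:
  assumes "0 \<le> s" "s \<le> t" "t \<le> t'"
  shows "flat s t' = flat s t \<inter> flat t t'"
proof (rule set_eqI)
  fix \<omega>
  show "\<omega> \<in> flat s t' \<longleftrightarrow> \<omega> \<in> flat s t \<inter> flat t t'"
    using A_mono[of \<omega> s t] A_mono[of \<omega> t t'] assms by (auto simp: flat_def)
qed

lemma flat_subset: "\<lbrakk>0 \<le> s; s \<le> t; t \<le> t'\<rbrakk> \<Longrightarrow> flat s t' \<subseteq> flat s t"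
  using flat_split[of s t t'] by blast

section \<open>Optional stopping along a grid\<close>

lemma X_submartingale:
  assumes "0 \<le> s" "s \<le> t" "B \<in> sets (F s)"
  shows "(\<integral>\<omega>. indicator B \<omega> * X s \<omega> \<partial>P) \<le> (\<integral>\<omega>. indicator B \<omega> * X t \<omega> \<partial>P)"
proof -
  have B: "B \<in> sets P" using sets_F[of s] assms by auto
  have int: "integrable P (\<lambda>\<omega>. indicator B \<omega> * Z \<omega>)" if "integrable P Z" for Z :: "'a \<Rightarrow> real"
    using integrable_mult_indicator[OF B that] by simp
  have decomp: "(\<integral>\<omega>. indicator B \<omega> * X v \<omega> \<partial>P)
      = (\<integral>\<omega>. indicator B \<omega> * N v \<omega> \<partial>P) + (\<integral>\<omega>. indicator B \<omega> * A v \<omega> \<partial>P)" if "0 \<le> v" for v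
  proof -
    have "(\<integral>\<omega>. indicator B \<omega> * X v \<omega> \<partial>P) = (\<integral>\<omega>. indicator B \<omega> * N v \<omega> + indicator B \<omega> * A v \<omega> \<partial>P)"
      by (intro Bochner_Integration.integral_cong) (auto simp: X_eq[OF that] distrib_left)
    then show ?thesis
      using Bochner_Integration.integral_add[OF int[OF N_integrable] int[OF A_integrable], of v v] that
      by simp
  qed
  have "(\<integral>\<omega>. indicator B \<omega> * A s \<omega> \<partial>P) \<le> (\<integral>\<omega>. indicator B \<omega> * A t \<omega> \<partial>P)"
    using assms by (intro integral_mono int A_integrable mult_left_mono A_mono) auto
  then show ?thesis
    using assms decomp[of s] decomp[of t] N_martingale[OF assms] by simp
qed

text \<open>On the event \<open>C\<close> that \<open>X s\<close> exceeds \<open>K\<close> the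
  excess at time \<open>s\<close> is affine in \<open>X s\<close>, so the submartingale property
  over \<open>C\<close> applies. At time \<open>t\<close> the difference \<open>X t - K\<close> is
  bounded by its positive part.\<close>

lemma X_excess_submartingale:
  assumes "0 \<le> s" "s \<le> t" "B \<in> sets (F s)"
  shows "(\<integral>\<omega>. indicator B \<omega> * max 0 (X s \<omega> - K) \<partial>P) \<le> (\<integral>\<omega>. indicator B \<omega> * max 0 (X t \<omega> - K) \<partial>P)"
proof -
  define C where "C = {\<omega> \<in> space (F s). K < X s \<omega>} \<inter> B"
  have [measurable]: "X s \<in> borel_measurable (F s)" "B \<in> sets (F s)"
    using X_adapted assms by auto
  have C: "C \<in> sets (F s)" unfolding C_def by measurable
  have CP: "C \<in> sets P" "B \<in> sets P" using C assms sets_F by auto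
  have int: "integrable P (\<lambda>\<omega>. indicator C \<omega> * Z \<omega>)" "integrable P (\<lambda>\<omega>. indicator B \<omega> * Z \<omega>)"
    if "integrable P Z" for Z :: "'a \<Rightarrow> real"
    using integrable_mult_indicator[OF _ that] CP by simp_all
  note XI = X_integrable[OF assms(1)] X_integrable[OF order_trans[OF assms(1,2)]]
  have "(\<integral>\<omega>. indicator B \<omega> * max 0 (X s \<omega> - K) \<partial>P) = (\<integral>\<omega>. indicator C \<omega> * (X s \<omega> - K) \<partial>P)"
    using assms(1) by (intro Bochner_Integration.integral_cong) (auto simp: C_def indicator_def space_F)
  also have "\<dots> = (\<integral>\<omega>. indicator C \<omega> * X s \<omega> \<partial>P) - (\<integral>\<omega>. indicator C \<omega> * K \<partial>P)"
    unfolding right_diff_distrib by (intro Bochner_Integration.integral_diff int XI integrable_const)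
  also have "\<dots> \<le> (\<integral>\<omega>. indicator C \<omega> * X t \<omega> \<partial>P) - (\<integral>\<omega>. indicator C \<omega> * K \<partial>P)"
    using X_submartingale[OF assms(1,2) C] by simp
  also have "\<dots> = (\<integral>\<omega>. indicator C \<omega> * (X t \<omega> - K) \<partial>P)"
    unfolding right_diff_distrib by (intro Bochner_Integration.integral_diff[symmetric] int XI integrable_const)
  also have "\<dots> \<le> (\<integral>\<omega>. indicator B \<omega> * max 0 (X t \<omega> - K) \<partial>P)"
    by (intro integral_mono int integrable_max Bochner_Integration.integrable_diff XI integrable_const)
      (auto simp: C_def indicator_def)
  finally show ?thesis .
qed

text \<open>The paths on which \<open>A\<close> moves before \<open>r\<close> are split according to
  the cell of first departure. On each piece the martingale \<open>N\<close> is evaluated at the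
  right end of the cell, so the gap becomes a sum of values taken shortly after the departure.
  Truncation at \<open>K\<close> separates a part amenable to dominated convergence from an excess
  that does not depend on the grid.\<close>

lemma X_flat_integral_gap:
  fixes K s r :: real and n :: nat
  defines "u \<equiv> \<lambda>i. s + (r - s) * real i / real (Suc n)"
  assumes s: "0 \<le> s" "s \<le> r" and B: "B \<in> sets (F s)" and K: "0 \<le> K"
  shows "\<bar>(\<integral>\<omega>. indicator B \<omega> * X s \<omega> \<partial>P) - (\<integral>\<omega>. indicator (B \<inter> flat s r) \<omega> * X r \<omega> \<partial>P)\<bar>
    \<le> (\<integral>\<omega>. (\<Sum>i<Suc n. (of_bool (A (u i) \<omega> = A s \<omega>) - of_bool (A (u (Suc i)) \<omega> = A s \<omega>)) *
            (min (X (u (Suc i)) \<omega>) K + (A (u (Suc i)) \<omega> - A s \<omega>))) \<partial>P)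
      + (\<integral>\<omega>. max 0 (X r \<omega> - K) \<partial>P)"
proof -
  have u: "s \<le> u i" "i \<le> j \<Longrightarrow> u i \<le> u j" "u 0 = s" "u (Suc n) = r" for i j
    using s by (simp_all add: u_def divide_right_mono mult_left_mono)
  have ur: "u i \<le> r" if "i \<le> Suc n" for i using u(2)[OF that] u(4) by simp
  have u0: "0 \<le> u i" for i using u(1)[of i] s by simp
  define J where "J C f = (\<integral>\<omega>. indicator C \<omega> * f \<omega> \<partial>P)" for C and f :: "'a \<Rightarrow> real"
  \<comment> \<open>The event that \<open>A\<close> first leaves its value at \<open>s\<close> in
    the cell from \<open>u i\<close> to \<open>u (Suc i)\<close>. Below, \<open>W i\<close> is the
    exact contribution of this event, and \<open>V i\<close> bounds its absolute value up to the
    excess over \<open>K\<close>.\<close>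
  define E where "E i = flat s (u i) - flat s (u (Suc i))" for i
  define V where "V i \<omega> = min (X (u (Suc i)) \<omega>) K + (A (u (Suc i)) \<omega> - A s \<omega>)" for i \<omega>
  define W where "W i \<omega> = X (u (Suc i)) \<omega> - (A (u (Suc i)) \<omega> - A s \<omega>)" for i \<omega>
  have int: "integrable P (\<lambda>\<omega>. indicator C \<omega> * f \<omega>)" if "C \<in> sets P" "integrable P f"
    for C and f :: "'a \<Rightarrow> real"
    using integrable_mult_indicator[OF that] by simp
  have J_add: "J C (\<lambda>\<omega>. f \<omega> + g \<omega>) = J C f + J C g"
    if "C \<in> sets P" "integrable P f" "integrable P g" for C f g
    unfolding J_def distrib_left by (intro Bochner_Integration.integral_add int that)
  have iX: "integrable P (X (u i))" and iA: "integrable P (A (u i))" and iN: "integrable P (N (u i))"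
    and iXr: "integrable P (X r)" "integrable P (N r)" and iS: "integrable P (A s)" "integrable P (N s)" for i
    using u0 s by (auto intro: X_integrable A_integrable N_integrable)
  have iexc: "integrable P (\<lambda>\<omega>. max 0 (f \<omega> - K))" if "integrable P f" for f
    by (intro integrable_max Bochner_Integration.integrable_diff that integrable_const)
  have iV: "integrable P (V i)" and iW: "integrable P (W i)" for i
    unfolding V_def W_def
    by (intro Bochner_Integration.integrable_add Bochner_Integration.integrable_diff integrable_min
        integrable_const iX iA iS)+
  have EF: "E i \<in> sets (F (u (Suc i)))" for i
    unfolding E_def using s u(1)[of i] u(1)[of "Suc i"] u(2)[of i "Suc i"]
    by (intro sets.Diff flat_sets F_mono[of "u i", THEN subsetD]) auto
  have BF: "B \<in> sets (F (u i))" for i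
    using F_mono[OF s(1) u(1)] B by auto
  have BE: "B \<inter> E i \<in> sets (F (u (Suc i)))" for i
    by (intro sets.Int EF BF)
  have sP: "B \<in> sets P" "E i \<in> sets P" "B \<inter> E i \<in> sets P" "B \<inter> flat s r \<in> sets P" for i
    using sets_F[OF s(1) B] sets_F[OF u0 EF] sets_F[OF u0 BE]
      sets_F[OF _ flat_sets[OF s]] s by auto
  have ind_E: "indicator (E i) \<omega> = (of_bool (A (u i) \<omega> = A s \<omega>) - of_bool (A (u (Suc i)) \<omega> = A s \<omega>) :: real)"
    if "\<omega> \<in> space P" for i \<omega>
  proof -
    have "flat s (u (Suc i)) \<subseteq> flat s (u i)" using s u(1) u(2)[of i "Suc i"] by (intro flat_subset) auto
    then show ?thesis using that by (auto simp: E_def flat_def indicator_def)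
  qed
  have sum_E: "(\<Sum>i<Suc n. indicator (E i) \<omega>) = (1 - indicator (flat s r) \<omega> :: real)"
    if "\<omega> \<in> space P" for \<omega>
  proof -
    have "(\<Sum>i<Suc n. indicator (E i) \<omega>)
       = (\<Sum>i<Suc n. of_bool (A (u i) \<omega> = A s \<omega>) - of_bool (A (u (Suc i)) \<omega> = A s \<omega>) :: real)"
      by (intro sum.cong refl ind_E that)
    also have "\<dots> = of_bool (A (u 0) \<omega> = A s \<omega>) - of_bool (A (u (Suc n)) \<omega> = A s \<omega>)"
      by (rule sum_lessThan_telescope')
    also have "\<dots> = 1 - indicator (flat s r) \<omega>"
      using that by (auto simp: u(3,4) flat_def indicator_def)
    finally show ?thesis .
  qed
  \<comment> \<open>On the flat event \<open>X r\<close> equals \<open>N r + A s\<close>. Over all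
    of \<open>B\<close> this expression has the same integral as \<open>X s\<close>, so the gap is
    its integral over the events \<open>B \<inter> E i\<close>.\<close>
  have "J (B \<inter> flat s r) (X r) = J (B \<inter> flat s r) (\<lambda>\<omega>. N r \<omega> + A s \<omega>)"
    unfolding J_def using s by (intro Bochner_Integration.integral_cong) (auto simp: flat_def indicator_def X_eq)
  also have "\<dots> = (\<integral>\<omega>. indicator B \<omega> * (N r \<omega> + A s \<omega>)
      - (\<Sum>i<Suc n. indicator (B \<inter> E i) \<omega> * (N r \<omega> + A s \<omega>)) \<partial>P)"
    unfolding J_def
  proof (intro Bochner_Integration.integral_cong refl)
    fix \<omega> assume "\<omega> \<in> space P"
    then have eq: "indicator (flat s r) \<omega> = (1 - (\<Sum>i<Suc n. indicator (E i) \<omega>) :: real)"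
      using sum_E by simp
    show "indicator (B \<inter> flat s r) \<omega> * (N r \<omega> + A s \<omega>) = indicator B \<omega> * (N r \<omega> + A s \<omega>)
        - (\<Sum>i<Suc n. indicator (B \<inter> E i) \<omega> * (N r \<omega> + A s \<omega>))"
      unfolding indicator_inter_arith eq sum_distrib_right[symmetric] sum_distrib_left[symmetric]
      by (simp only: right_diff_distrib left_diff_distrib mult_1_right)
  qed
  also have "\<dots> = J B (\<lambda>\<omega>. N r \<omega> + A s \<omega>) - (\<Sum>i<Suc n. J (B \<inter> E i) (\<lambda>\<omega>. N r \<omega> + A s \<omega>))"
    unfolding J_def
    by (subst Bochner_Integration.integral_diff Bochner_Integration.integral_sum;
        intro Bochner_Integration.integrable_sum int sP Bochner_Integration.integrable_add iXr iS arg_cong2[where f = minus] refl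
        Bochner_Integration.integral_sum)
  also have "J B (\<lambda>\<omega>. N r \<omega> + A s \<omega>) = J B (X s)"
  proof -
    have "J B (X s) = J B (\<lambda>\<omega>. N s \<omega> + A s \<omega>)"
      unfolding J_def using s by (intro Bochner_Integration.integral_cong) (auto simp: X_eq)
    then show ?thesis
      using N_martingale[OF s B] by (simp add: J_add sP iXr iS) (simp add: J_def)
  qed
  also have "(\<Sum>i<Suc n. J (B \<inter> E i) (\<lambda>\<omega>. N r \<omega> + A s \<omega>)) = (\<Sum>i<Suc n. J (B \<inter> E i) (W i))"
  proof (rule sum.cong[OF refl])
    fix i assume i: "i \<in> {..<Suc n}"
    have "J (B \<inter> E i) (W i) = J (B \<inter> E i) (\<lambda>\<omega>. N (u (Suc i)) \<omega> + A s \<omega>)"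
      unfolding J_def using u0 by (intro Bochner_Integration.integral_cong) (auto simp: W_def X_eq)
    \<comment> \<open>The event is known at time \<open>u (Suc i)\<close>, so the martingale may be
      moved from \<open>r\<close> back to the end of the cell.\<close>
    moreover have "J (B \<inter> E i) (N r) = J (B \<inter> E i) (N (u (Suc i)))"
      unfolding J_def using i by (intro N_martingale u0 ur BE) auto
    ultimately show "J (B \<inter> E i) (\<lambda>\<omega>. N r \<omega> + A s \<omega>) = J (B \<inter> E i) (W i)"
      by (simp add: J_add sP iXr iS iN)
  qed
  finally have gap: "J B (X s) - J (B \<inter> flat s r) (X r) = (\<Sum>i<Suc n. J (B \<inter> E i) (W i))"
    by simp
  have term_le: "\<bar>J (B \<inter> E i) (W i)\<bar> \<le> J (E i) (V i) + J (E i) (\<lambda>\<omega>. max 0 (X r \<omega> - K))"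
    if i: "i \<in> {..<Suc n}" for i
  proof -
    have "\<bar>J (B \<inter> E i) (W i)\<bar> \<le> (\<integral>\<omega>. \<bar>indicator (B \<inter> E i) \<omega> * W i \<omega>\<bar> \<partial>P)"
      unfolding J_def by (rule integral_abs_bound)
    also have "\<dots> \<le> J (E i) (\<lambda>\<omega>. V i \<omega> + max 0 (X (u (Suc i)) \<omega> - K))"
      unfolding J_def
    proof (intro integral_mono integrable_abs int sP iW Bochner_Integration.integrable_add iV iexc iX)
      fix \<omega> assume \<omega>: "\<omega> \<in> space P"
      have "0 \<le> X (u (Suc i)) \<omega>" "A s \<omega> \<le> A (u (Suc i)) \<omega>"
        using \<omega> s u0 u(1) by (auto intro: X_nonneg A_mono)
      then have "\<bar>W i \<omega>\<bar> \<le> V i \<omega> + max 0 (X (u (Suc i)) \<omega> - K)"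
        by (auto simp: W_def V_def)
      moreover from this have "0 \<le> V i \<omega> + max 0 (X (u (Suc i)) \<omega> - K)" by linarith
      ultimately show "\<bar>indicator (B \<inter> E i) \<omega> * W i \<omega>\<bar>
          \<le> indicator (E i) \<omega> * (V i \<omega> + max 0 (X (u (Suc i)) \<omega> - K))"
        by (simp add: indicator_def)
    qed
    also have "\<dots> = J (E i) (V i) + J (E i) (\<lambda>\<omega>. max 0 (X (u (Suc i)) \<omega> - K))"
      by (intro J_add sP iV iexc iX)
    also have "J (E i) (\<lambda>\<omega>. max 0 (X (u (Suc i)) \<omega> - K)) \<le> J (E i) (\<lambda>\<omega>. max 0 (X r \<omega> - K))"
      unfolding J_def using i by (intro X_excess_submartingale u0 ur EF) auto
    finally show ?thesis by simp
  qed
  have "\<bar>J B (X s) - J (B \<inter> flat s r) (X r)\<bar> \<le> (\<Sum>i<Suc n. \<bar>J (B \<inter> E i) (W i)\<bar>)"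
    unfolding gap by (rule sum_abs)
  also have "\<dots> \<le> (\<Sum>i<Suc n. J (E i) (V i) + J (E i) (\<lambda>\<omega>. max 0 (X r \<omega> - K)))"
    by (intro sum_mono term_le)
  also have "\<dots> = (\<Sum>i<Suc n. J (E i) (V i)) + (\<Sum>i<Suc n. J (E i) (\<lambda>\<omega>. max 0 (X r \<omega> - K)))"
    by (rule sum.distrib)
  also have "(\<Sum>i<Suc n. J (E i) (V i)) = (\<integral>\<omega>. (\<Sum>i<Suc n. indicator (E i) \<omega> * V i \<omega>) \<partial>P)"
    unfolding J_def by (intro Bochner_Integration.integral_sum[symmetric] int sP iV)
  also have "\<dots> = (\<integral>\<omega>. (\<Sum>i<Suc n. (of_bool (A (u i) \<omega> = A s \<omega>) - of_bool (A (u (Suc i)) \<omega> = A s \<omega>)) *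
            (min (X (u (Suc i)) \<omega>) K + (A (u (Suc i)) \<omega> - A s \<omega>))) \<partial>P)"
    unfolding V_def by (intro Bochner_Integration.integral_cong refl sum.cong) (simp only: ind_E)
  also have "(\<Sum>i<Suc n. J (E i) (\<lambda>\<omega>. max 0 (X r \<omega> - K)))
      = (\<integral>\<omega>. (\<Sum>i<Suc n. indicator (E i) \<omega> * max 0 (X r \<omega> - K)) \<partial>P)"
    unfolding J_def by (intro Bochner_Integration.integral_sum[symmetric] int sP iexc iXr)
  \<comment> \<open>The indicators of the \<open>E i\<close> add up to at most 1, so the excesses of
    all cells together cost only one excess at time \<open>r\<close>.\<close>
  also have "\<dots> \<le> (\<integral>\<omega>. max 0 (X r \<omega> - K) \<partial>P)"
  proof (intro integral_mono Bochner_Integration.integrable_sum int sP iexc iXr)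
    fix \<omega> assume "\<omega> \<in> space P"
    then show "(\<Sum>i<Suc n. indicator (E i) \<omega> * max 0 (X r \<omega> - K)) \<le> max 0 (X r \<omega> - K)"
      unfolding sum_distrib_right[symmetric] by (subst sum_E) (simp_all add: indicator_def)
  qed
  finally show ?thesis by (simp add: J_def)
qed

lemma excess_integral_tendsto_0:
  assumes "0 \<le> r"
  shows "(\<lambda>k. \<integral>\<omega>. max 0 (X r \<omega> - real k) \<partial>P) \<longlonglongrightarrow> 0"
proof -
  have [measurable]: "X r \<in> borel_measurable P" using X_integrable[OF assms] by auto
  have "(\<lambda>k. \<integral>\<omega>. max 0 (X r \<omega> - real k) \<partial>P) \<longlonglongrightarrow> (\<integral>\<omega>. 0 \<partial>P)"
  proof (rule integral_dominated_convergence[where w = "\<lambda>\<omega>. \<bar>X r \<omega>\<bar>"])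
    show "integrable P (\<lambda>\<omega>. \<bar>X r \<omega>\<bar>)" using X_integrable[OF assms] by simp
    show "AE \<omega> in P. (\<lambda>k. max 0 (X r \<omega> - real k)) \<longlonglongrightarrow> 0"
    proof (rule AE_I2, rule tendsto_eventually)
      fix \<omega>
      obtain m :: nat where "X r \<omega> \<le> real m" using real_arch_simple by blast
      then show "\<forall>\<^sub>F k in sequentially. max 0 (X r \<omega> - real k) = 0"
        by (intro eventually_sequentiallyI[of m]) auto
    qed
  qed auto
  then show ?thesis by simp
qed

text \<open>\<open>X\<close> is a martingale as long as \<open>A\<close> does not move, and it vanishes at the moment \<open>A\<close> starts to
  increase.\<close>

lemma X_flat_integral:
  assumes s: "0 \<le> s" "s \<le> r" and B: "B \<in> sets (F s)"
  shows "(\<integral>\<omega>. indicator (B \<inter> flat s r) \<omega> * X r \<omega> \<partial>P) = (\<integral>\<omega>. indicator B \<omega> * X s \<omega> \<partial>P)"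
proof -
  let ?u = "\<lambda>n i. s + (r - s) * real i / real (Suc n)"
  let ?H = "\<lambda>K n \<omega>. \<Sum>i<Suc n. (of_bool (A (?u n i) \<omega> = A s \<omega>) - of_bool (A (?u n (Suc i)) \<omega> = A s \<omega>)) *
            (min (X (?u n (Suc i)) \<omega>) K + (A (?u n (Suc i)) \<omega> - A s \<omega>))"
  let ?gap = "\<bar>(\<integral>\<omega>. indicator B \<omega> * X s \<omega> \<partial>P) - (\<integral>\<omega>. indicator (B \<inter> flat s r) \<omega> * X r \<omega> \<partial>P)\<bar>"
  have r: "0 \<le> r" using s by simp
  have u: "s \<le> ?u n i" "0 \<le> ?u n i" "i \<le> Suc n \<Longrightarrow> ?u n i \<le> r" for n i
  proof -
    show "s \<le> ?u n i" using s by simp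
    then show "0 \<le> ?u n i" using s by linarith
    assume "i \<le> Suc n"
    then have "(r - s) * real i / real (Suc n) \<le> (r - s) * 1"
      unfolding times_divide_eq_right[symmetric] using s by (intro mult_left_mono) auto
    then show "?u n i \<le> r" by simp
  qed
  have meas: "X (?u n i) \<in> borel_measurable P" "A (?u n i) \<in> borel_measurable P" for n i
    using X_integrable[OF u(2)] A_integrable[OF u(2)] by auto
  have As: "A s \<in> borel_measurable P" using A_integrable[OF s(1)] by auto
  note [measurable] = meas As
  \<comment> \<open>The level \<open>k\<close> stays fixed while the grid is refined; only
    afterwards does \<open>k\<close> tend to infinity.\<close>
  have "?gap \<le> (\<integral>\<omega>. max 0 (X r \<omega> - real k) \<partial>P)" for k
  proof -
    have "(\<lambda>n. \<integral>\<omega>. ?H (real k) n \<omega> \<partial>P) \<longlonglongrightarrow> (\<integral>\<omega>. 0 \<partial>P)"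
    proof (rule integral_dominated_convergence[where w = "\<lambda>\<omega>. real k + (A r \<omega> - A s \<omega>)"])
      show "integrable P (\<lambda>\<omega>. real k + (A r \<omega> - A s \<omega>))"
        by (intro Bochner_Integration.integrable_add Bochner_Integration.integrable_diff
            integrable_const A_integrable s r)
      show "AE \<omega> in P. (\<lambda>n. ?H (real k) n \<omega>) \<longlonglongrightarrow> 0"
        using s by (intro AE_I2 first_increase_sum_tendsto_0 A_cont A_mono_on X_right_cont X_nonneg zero_between) auto
      \<comment> \<open>The weights are nonnegative with sum at most 1, so the whole sum is bounded
        like a single summand.\<close>
      show "AE \<omega> in P. norm (?H (real k) n \<omega>) \<le> real k + (A r \<omega> - A s \<omega>)" for n
      proof (rule AE_I2)
        fix \<omega> assume \<omega>: "\<omega> \<in> space P"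
        let ?d = "\<lambda>i. of_bool (A (?u n i) \<omega> = A s \<omega>) - of_bool (A (?u n (Suc i)) \<omega> = A s \<omega>) :: real"
        have d: "0 \<le> ?d i" if "i < Suc n" for i
        proof -
          have "?u n i \<le> ?u n (Suc i)" using s by (simp add: divide_right_mono mult_left_mono)
          then have "A s \<omega> \<le> A (?u n i) \<omega>" "A (?u n i) \<omega> \<le> A (?u n (Suc i)) \<omega>"
            using \<omega> s u by (auto intro: A_mono)
          then show ?thesis by auto
        qed
        have V: "\<bar>min (X (?u n (Suc i)) \<omega>) (real k) + (A (?u n (Suc i)) \<omega> - A s \<omega>)\<bar>
            \<le> real k + (A r \<omega> - A s \<omega>)" if "i < Suc n" for i
        proof -
          have "0 \<le> X (?u n (Suc i)) \<omega>" by (rule X_nonneg[OF u(2) \<omega>])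
          moreover have "A s \<omega> \<le> A (?u n (Suc i)) \<omega>" by (rule A_mono[OF \<omega> s(1) u(1)])
          moreover have "A (?u n (Suc i)) \<omega> \<le> A r \<omega>" using that by (intro A_mono[OF \<omega> u(2,3)]) simp
          ultimately show ?thesis by auto
        qed
        have "norm (?H (real k) n \<omega>) \<le> (\<Sum>i<Suc n. ?d i * (real k + (A r \<omega> - A s \<omega>)))"
        proof (rule sum_norm_le)
          fix i assume "i \<in> {..<Suc n}"
          then have i: "i < Suc n" by simp
          show "norm (?d i * (min (X (?u n (Suc i)) \<omega>) (real k) + (A (?u n (Suc i)) \<omega> - A s \<omega>)))
              \<le> ?d i * (real k + (A r \<omega> - A s \<omega>))"
            unfolding real_norm_def abs_mult abs_of_nonneg[OF d[OF i]]
            by (rule mult_left_mono[OF V[OF i] d[OF i]])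
        qed
        also have "\<dots> = (1 - of_bool (A (?u n (Suc n)) \<omega> = A s \<omega>)) * (real k + (A r \<omega> - A s \<omega>))"
          unfolding sum_distrib_right[symmetric]
          by (subst sum_lessThan_telescope'[where f = "\<lambda>i. of_bool (A (?u n i) \<omega> = A s \<omega>) :: real"]) simp
        also have "\<dots> \<le> real k + (A r \<omega> - A s \<omega>)"
          using A_mono[OF \<omega> s] by auto
        finally show "norm (?H (real k) n \<omega>) \<le> real k + (A r \<omega> - A s \<omega>)" .
      qed
      show "(\<lambda>\<omega>. ?H (real k) n \<omega>) \<in> borel_measurable P" for n
        unfolding of_bool_def by measurable
    qed simp
    then have "(\<lambda>n. (\<integral>\<omega>. ?H (real k) n \<omega> \<partial>P) + (\<integral>\<omega>. max 0 (X r \<omega> - real k) \<partial>P))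
        \<longlonglongrightarrow> 0 + (\<integral>\<omega>. max 0 (X r \<omega> - real k) \<partial>P)"
      by (intro tendsto_add tendsto_const) simp
    then show ?thesis
      using X_flat_integral_gap[OF s B, of "real k"] by (intro LIMSEQ_le_const) auto
  qed
  then have "?gap \<le> 0"
    using excess_integral_tendsto_0[OF r] by (intro LIMSEQ_le_const) auto
  then show ?thesis by simp
qed

section \<open>Measures with density \<open>X\<close> on flat periods\<close>

lemma measurable_P: "0 \<le> t \<Longrightarrow> X t \<in> borel_measurable P" "0 \<le> t \<Longrightarrow> A t \<in> borel_measurable P"
  using X_integrable A_integrable by auto

definition flat_measure :: "real \<Rightarrow> real \<Rightarrow> 'a measure" where
  "flat_measure s t = density P (\<lambda>\<omega>. ennreal (indicator (flat s t) \<omega> * X t \<omega>))"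

lemma sets_flat_measure [simp, measurable_cong]: "sets (flat_measure s t) = sets P"
  and space_flat_measure [simp]: "space (flat_measure s t) = space P"
  by (simp_all add: flat_measure_def)

lemma emeasure_flat_measure:
  assumes "0 \<le> s" "s \<le> t" "B \<in> sets P"
  shows "emeasure (flat_measure s t) B = ennreal (\<integral>\<omega>. indicator (B \<inter> flat s t) \<omega> * X t \<omega> \<partial>P)"
proof -
  have fl: "flat s t \<in> sets P" using flat_sets[OF assms(1,2)] sets_F[of t] assms by auto
  have t: "0 \<le> t" using assms by simp
  note [measurable] = fl measurable_P(1)[OF t] assms(3)
  have "emeasure (flat_measure s t) B = (\<integral>\<^sup>+\<omega>. ennreal (indicator (flat s t) \<omega> * X t \<omega>) * indicator B \<omega> \<partial>P)"
    unfolding flat_measure_def by (intro emeasure_density) measurable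
  also have "\<dots> = (\<integral>\<^sup>+\<omega>. ennreal (indicator (B \<inter> flat s t) \<omega> * X t \<omega>) \<partial>P)"
    by (intro nn_integral_cong) (simp add: indicator_def)
  also have "\<dots> = ennreal (\<integral>\<omega>. indicator (B \<inter> flat s t) \<omega> * X t \<omega> \<partial>P)"
    using integrable_mult_indicator[OF sets.Int[OF assms(3) fl] X_integrable[OF t]] X_nonneg[OF t]
    by (intro nn_integral_eq_integral) auto
  finally show ?thesis .
qed

lemma flat_refl: "flat s s = space P"
  by (auto simp: flat_def)

lemma emeasure_flat_measure_refl:
  assumes "0 \<le> t" "B \<in> sets P"
  shows "emeasure (flat_measure t t) B = ennreal (\<integral>\<omega>. indicator B \<omega> * X t \<omega> \<partial>P)"
  using emeasure_flat_measure[OF assms(1) order_refl assms(2)] sets.sets_into_space[OF assms(2)]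
  by (simp add: flat_refl Int_absorb2)

text \<open>This is \<open>X_flat_integral\<close> between \<open>t\<close> and \<open>r\<close>,
  applied to the event \<open>B \<inter> flat s t\<close>, which belongs to \<open>F t\<close>. Only
  events of \<open>F t\<close> are covered: on larger sigma-algebras the two measures may
  differ.\<close>

lemma flat_measure_extends:
  assumes "0 \<le> s" "s \<le> t" "t \<le> r" "B \<in> sets (F t)"
  shows "emeasure (flat_measure s r) B = emeasure (flat_measure s t) B"
proof -
  have t: "0 \<le> t" and B: "B \<in> sets P" using assms sets_F[of t] by auto
  have "B \<inter> flat s r = (B \<inter> flat s t) \<inter> flat t r"
    using flat_split[OF assms(1-3)] by auto
  then show ?thesis
    using X_flat_integral[OF t assms(3), of "B \<inter> flat s t"] flat_sets[OF assms(1,2)] assms B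
    by (simp add: emeasure_flat_measure sets.Int)
qed

text \<open>Both densities use \<open>X r\<close>, and \<open>flat s r\<close> is contained in
  \<open>flat t r\<close>. So the measure started at \<open>s\<close> is a restriction of the one
  started at \<open>t\<close>.\<close>

lemma flat_measure_Int_flat:
  assumes "0 \<le> s" "s \<le> t" "t \<le> r" "B \<in> sets P"
  shows "emeasure (flat_measure t r) (B \<inter> flat s r) = emeasure (flat_measure s r) B"
proof -
  have "flat s r \<in> sets P" using flat_sets[of s r] sets_F[of r] assms by auto
  moreover have "B \<inter> flat s r \<inter> flat t r = B \<inter> flat s r"
    using flat_split[OF assms(1-3)] by auto
  ultimately show ?thesis
    using assms by (simp add: emeasure_flat_measure sets.Int)
qed

text \<open>Doob's maximal inequality for the reciprocal of \<open>X\<close> under \<^const>\<open>flat_measure\<close>, split over the first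
  time in \<open>U\<close> at which \<open>X\<close> is below \<open>\<epsilon>\<close>.\<close>

lemma flat_measure_small_finite:
  assumes s: "0 \<le> s" and U: "finite U" "U \<subseteq> {s..t}" and "0 \<le> \<epsilon>"
  shows "emeasure (flat_measure s t) {\<omega> \<in> space P. \<exists>u\<in>U. X u \<omega> < \<epsilon>} \<le> ennreal \<epsilon>"
proof (cases "U = {}")
  case False
  then have st: "s \<le> t" using U by force
  \<comment> \<open>The event that \<open>u\<close> is the first time in \<open>U\<close> with
    \<open>X\<close> below \<open>\<epsilon>\<close>; it is decided at time
    \<open>u\<close>.\<close>
  define B where "B u = {\<omega> \<in> space P. X u \<omega> < \<epsilon> \<and> (\<forall>v\<in>{v \<in> U. v < u}. \<epsilon> \<le> X v \<omega>)}" for u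
  have u0: "0 \<le> u" "s \<le> u" "u \<le> t" if "u \<in> U" for u using that U s by auto
  have BF: "B u \<in> sets (F u)" if u: "u \<in> U" for u
  proof -
    have [measurable]: "X u \<in> borel_measurable (F u)" by (intro X_adapted u0 u)
    have [measurable]: "X v \<in> borel_measurable (F u)" if "v \<in> {v \<in> U. v < u}" for v
      using that u0 by (intro adapted_mono[of v u] X_adapted) auto
    have fin: "finite {v \<in> U. v < u}" using U by simp
    have "{\<omega> \<in> space (F u). X u \<omega> < \<epsilon> \<and> (\<forall>v\<in>{v \<in> U. v < u}. \<epsilon> \<le> X v \<omega>)} \<in> sets (F u)"
      by (intro sets.sets_Collect_conj sets.sets_Collect_finite_All fin) measurable
    then show ?thesis using space_F[OF u0(1)[OF u]] by (simp add: B_def)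
  qed
  have BP: "B u \<in> sets P" if "u \<in> U" for u using sets_F[OF u0(1) BF] that by blast
  have "{\<omega> \<in> space P. \<exists>u\<in>U. X u \<omega> < \<epsilon>} \<subseteq> (\<Union>u\<in>U. B u)"
  proof
    fix \<omega> assume "\<omega> \<in> {\<omega> \<in> space P. \<exists>u\<in>U. X u \<omega> < \<epsilon>}"
    then have \<omega>: "\<omega> \<in> space P" "{u \<in> U. X u \<omega> < \<epsilon>} \<noteq> {}" by auto
    define m where "m = Min {u \<in> U. X u \<omega> < \<epsilon>}"
    have fin: "finite {u \<in> U. X u \<omega> < \<epsilon>}" using U by simp
    have m: "m \<in> {u \<in> U. X u \<omega> < \<epsilon>}" unfolding m_def by (rule Min_in[OF fin \<omega>(2)])
    have "\<epsilon> \<le> X v \<omega>" if "v \<in> U" "v < m" for v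
      using Min_le[OF fin, of v] that by (force simp: m_def)
    then have "\<omega> \<in> B m" using m \<omega> by (auto simp: B_def)
    then show "\<omega> \<in> (\<Union>u\<in>U. B u)" using m by blast
  qed
  then have "emeasure (flat_measure s t) {\<omega> \<in> space P. \<exists>u\<in>U. X u \<omega> < \<epsilon>}
      \<le> emeasure (flat_measure s t) (\<Union>u\<in>U. B u)"
    using BP U by (intro emeasure_mono) auto
  also have "\<dots> \<le> (\<Sum>u\<in>U. emeasure (flat_measure s t) (B u))"
    using BP U by (intro emeasure_subadditive_finite) auto
  also have "\<dots> \<le> (\<Sum>u\<in>U. ennreal \<epsilon> * emeasure P (B u))"
  proof (rule sum_mono)
    fix u assume u: "u \<in> U"
    note u' = u0[OF u]
    \<comment> \<open>Restart at \<open>u\<close>, drop the flatness between \<open>s\<close> and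
      \<open>u\<close>, and use consistency to return from \<open>t\<close> to \<open>u\<close>.
      There the density is \<open>X u\<close>, which is below \<open>\<epsilon>\<close> on
      \<open>B u\<close>.\<close>
    have "emeasure (flat_measure s t) (B u) = emeasure (flat_measure u t) (B u \<inter> flat s t)"
      using flat_measure_Int_flat[OF s u'(2,3) BP[OF u]] by simp
    also have "\<dots> \<le> emeasure (flat_measure u t) (B u)"
      using BP[OF u] by (intro emeasure_mono) auto
    also have "\<dots> = emeasure (flat_measure u u) (B u)"
      by (rule flat_measure_extends[OF u'(1) order_refl u'(3) BF[OF u]])
    also have "\<dots> = ennreal (\<integral>\<omega>. indicator (B u) \<omega> * X u \<omega> \<partial>P)"
      by (rule emeasure_flat_measure_refl[OF u'(1) BP[OF u]])
    also have "\<dots> \<le> ennreal (\<integral>\<omega>. indicator (B u) \<omega> * \<epsilon> \<partial>P)"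
      using integrable_mult_indicator[OF BP[OF u] X_integrable[OF u'(1)]] BP[OF u]
        integrable_mult_indicator[OF BP[OF u], of "\<lambda>_. \<epsilon>"]
      by (intro ennreal_leI integral_mono) (auto simp: B_def indicator_def)
    also have "\<dots> = ennreal \<epsilon> * emeasure P (B u)"
      using BP[OF u] \<open>0 \<le> \<epsilon>\<close> by (simp add: emeasure_eq_measure ennreal_mult' mult.commute)
    finally show "emeasure (flat_measure s t) (B u) \<le> ennreal \<epsilon> * emeasure P (B u)" .
  qed
  also have "\<dots> = ennreal \<epsilon> * emeasure P (\<Union>u\<in>U. B u)"
  proof -
    have "disjoint_family_on B U"
      unfolding disjoint_family_on_def
    proof (intro ballI impI)
      fix u v assume "u \<in> U" "v \<in> U" "u \<noteq> v"
      then show "B u \<inter> B v = {}"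
        by (cases "u < v") (force simp: B_def not_less)+
    qed
    then show ?thesis
      using BP U by (subst sum_emeasure[symmetric]) (auto simp: sum_distrib_left)
  qed
  also have "\<dots> \<le> ennreal \<epsilon> * 1"
    by (intro mult_left_mono emeasure_le_1) auto
  finally show ?thesis by simp
qed simp

lemma flat_measure_small_countable:
  assumes s: "0 \<le> s" and U: "countable U" "U \<subseteq> {s..t}" and "0 \<le> \<epsilon>"
  shows "emeasure (flat_measure s t) {\<omega> \<in> space P. \<exists>u\<in>U. X u \<omega> < \<epsilon>} \<le> ennreal \<epsilon>"
proof (cases "U = {}")
  case False
  define S where "S n = {\<omega> \<in> space P. \<exists>u\<in>from_nat_into U ` {..n}. X u \<omega> < \<epsilon>}" for n :: nat
  have sub: "from_nat_into U ` {..n} \<subseteq> {s..t}" for n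
    using from_nat_into[OF False] U by auto
  have "X u \<in> borel_measurable P" if "u \<in> {s..t}" for u
    using that s by (intro measurable_P) auto
  then have meas: "{\<omega> \<in> space P. X u \<omega> < \<epsilon>} \<in> sets P" if "u \<in> {s..t}" for u
    using that by measurable
  have S: "S n \<in> sets P" for n
  proof -
    have "S n = (\<Union>u\<in>from_nat_into U ` {..n}. {\<omega> \<in> space P. X u \<omega> < \<epsilon>})" by (auto simp: S_def)
    also have "\<dots> \<in> sets P" by (intro sets.finite_UN finite_imageI finite_atMost meas subsetD[OF sub])
    finally show ?thesis .
  qed
  have eq: "{\<omega> \<in> space P. \<exists>u\<in>U. X u \<omega> < \<epsilon>} = (\<Union>n. S n)"
    using from_nat_into_surj[OF U(1)] from_nat_into[OF False] by (fastforce simp: S_def)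
  have sup: "(SUP n. emeasure (flat_measure s t) (S n)) = emeasure (flat_measure s t) (\<Union>n. S n)"
    using S by (intro SUP_emeasure_incseq) (auto simp: S_def incseq_def intro: order_trans)
  have "emeasure (flat_measure s t) (S n) \<le> ennreal \<epsilon>" for n
    unfolding S_def using s sub \<open>0 \<le> \<epsilon>\<close> by (intro flat_measure_small_finite) auto
  then show ?thesis unfolding eq sup[symmetric] by (rule SUP_least)
qed simp

section \<open>Approaching zero during a flat period\<close>

definition near_zero :: "real \<Rightarrow> real \<Rightarrow> 'a set" where
  "near_zero s t = {\<omega> \<in> flat s t. \<forall>k. \<exists>u\<in>\<rat> \<inter> {s..t}. X u \<omega> < 1 / real (Suc k)}"

text \<open>Rational times and the thresholds \<open>1 / real (Suc k)\<close> keep this a countable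
  combination of events of \<open>F t\<close>, whereas an exact zero in \<open>{s..t}\<close> would
  be a condition on uncountably many times.\<close>

lemma near_zero_sets:
  assumes "0 \<le> s" "s \<le> t"
  shows "near_zero s t \<in> sets (F t)"
proof -
  have "X u \<in> borel_measurable (F t)" if "u \<in> \<rat> \<inter> {s..t}" for u
    using that assms by (intro adapted_mono[of u t] X_adapted) auto
  then have meas: "{\<omega> \<in> space (F t). X u \<omega> < c} \<in> sets (F t)" if "u \<in> \<rat> \<inter> {s..t}" for u c
    using that by measurable
  have "countable (\<rat> \<inter> {s..t})" using countable_rat by blast
  then have "(\<Inter>k. \<Union>u\<in>\<rat> \<inter> {s..t}. {\<omega> \<in> space (F t). X u \<omega> < 1 / real (Suc k)}) \<in> sets (F t)"
    using meas by (intro sets.countable_INT sets.countable_UN') auto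
  moreover have "near_zero s t
      = flat s t \<inter> (\<Inter>k. \<Union>u\<in>\<rat> \<inter> {s..t}. {\<omega> \<in> space (F t). X u \<omega> < 1 / real (Suc k)})"
    using assms space_F[of t] by (auto simp: near_zero_def flat_def)
  ultimately show ?thesis using flat_sets[OF assms] by simp
qed

lemma near_zero_null:
  assumes "0 \<le> s" "s \<le> t"
  shows "emeasure (flat_measure s t) (near_zero s t) = 0"
proof -
  have U: "countable (\<rat> \<inter> {s..t})" using countable_rat by blast
  have "emeasure (flat_measure s t) (near_zero s t) \<le> ennreal (1 / real (Suc k))" for k
  proof -
    let ?S = "{\<omega> \<in> space P. \<exists>u\<in>\<rat> \<inter> {s..t}. X u \<omega> < 1 / real (Suc k)}"
    have "X u \<in> borel_measurable P" if "u \<in> \<rat> \<inter> {s..t}" for u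
      using that assms by (intro measurable_P) auto
    then have "{\<omega> \<in> space P. X u \<omega> < 1 / real (Suc k)} \<in> sets P" if "u \<in> \<rat> \<inter> {s..t}" for u
      using that by measurable
    then have "(\<Union>u\<in>\<rat> \<inter> {s..t}. {\<omega> \<in> space P. X u \<omega> < 1 / real (Suc k)}) \<in> sets P"
      using U by (intro sets.countable_UN') auto
    moreover have "(\<Union>u\<in>\<rat> \<inter> {s..t}. {\<omega> \<in> space P. X u \<omega> < 1 / real (Suc k)}) = ?S" by auto
    ultimately have "emeasure (flat_measure s t) (near_zero s t) \<le> emeasure (flat_measure s t) ?S"
      by (intro emeasure_mono) (auto simp: near_zero_def flat_def)
    also have "\<dots> \<le> ennreal (1 / real (Suc k))"
      using assms U by (intro flat_measure_small_countable) auto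
    finally show ?thesis .
  qed
  moreover have "(\<lambda>k. ennreal (1 / real (Suc k))) \<longlonglongrightarrow> ennreal 0"
    using LIMSEQ_inverse_real_of_nat by (intro tendsto_ennrealI) (simp add: inverse_eq_divide)
  ultimately have "emeasure (flat_measure s t) (near_zero s t) \<le> ennreal 0"
    by (intro LIMSEQ_le_const) auto
  then show ?thesis by simp
qed

section \<open>The event \<open>{A\<^sub>\<infinity> = A\<^sub>t}\<close> and its relation to
  \<open>{g \<le> t}\<close>\<close>

definition flat_forever :: "real \<Rightarrow> 'a set" where
  "flat_forever t = {\<omega> \<in> space P. \<forall>k::nat. t \<le> real k \<longrightarrow> A (real k) \<omega> = A t \<omega>}"

text \<open>Integer times keep the defining condition countable; monotonicity of \<open>A\<close>
  fills in the times between them.\<close>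

lemma flat_forever_flat:
  assumes "0 \<le> t" "t \<le> s" "\<omega> \<in> flat_forever t"
  shows "\<omega> \<in> flat t s"
proof -
  obtain k :: nat where k: "s \<le> real k" using real_arch_simple by blast
  have "\<omega> \<in> flat t (real k)" using assms k by (auto simp: flat_forever_def flat_def)
  then show ?thesis using flat_subset[OF assms(1,2) k] by blast
qed

lemma flat_forever_sets:
  assumes "0 \<le> t"
  shows "flat_forever t \<in> sets P"
proof -
  have "flat_forever t = space P \<inter> (\<Inter>k\<in>{k. t \<le> real k}. flat t (real k))"
    by (auto simp: flat_forever_def flat_def)
  moreover have "{k. t \<le> real k} \<noteq> {}" using real_arch_simple by blast
  moreover have "flat t (real k) \<in> sets P" if "t \<le> real k" for k
    using flat_sets[OF assms that] sets_F[of "real k"] by simp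
  ultimately show ?thesis
    by (simp only:) (intro sets.Int sets.top sets.countable_INT', auto)
qed

lemma flat_forever_split:
  assumes "0 \<le> s" "s \<le> t"
  shows "flat_forever s = flat s t \<inter> flat_forever t"
proof
  show "flat_forever s \<subseteq> flat s t \<inter> flat_forever t"
    using flat_forever_flat[OF assms] assms by (auto simp: flat_forever_def flat_def)
  show "flat s t \<inter> flat_forever t \<subseteq> flat_forever s"
  proof
    fix \<omega> assume \<omega>: "\<omega> \<in> flat s t \<inter> flat_forever t"
    have "\<omega> \<in> flat s (real k)" if "s \<le> real k" for k
    proof (cases "t \<le> real k")
      case True
      then show ?thesis using \<omega> by (auto simp: flat_forever_def flat_def)
    next
      case False
      then show ?thesis using flat_subset[OF assms(1) that, of t] \<omega> by auto
    qed
    then show "\<omega> \<in> flat_forever s" using \<omega> by (auto simp: flat_forever_def flat_def)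
  qed
qed

text \<open>An increase of \<open>A\<close> after \<open>t\<close> forces a zero of \<open>X\<close>
  strictly after \<open>t\<close>, hence g > t.\<close>

lemma flat_forever_of_last_zero_le:
  assumes "0 \<le> t" "\<omega> \<in> space P" "last_zero X \<omega> \<le> ennreal t"
  shows "\<omega> \<in> flat_forever t"
proof -
  have "A (real k) \<omega> = A t \<omega>" if k: "t \<le> real k" for k
  proof (rule ccontr)
    assume "A (real k) \<omega> \<noteq> A t \<omega>"
    moreover have "A t \<omega> \<le> A (real k) \<omega>" by (rule A_mono[OF assms(2,1) k])
    ultimately have lt: "A t \<omega> < A (real k) \<omega>" by simp
    then have "t < real k" using k by (auto simp: less_le)
    then obtain w where w: "t < w" "X w \<omega> = 0" using zero_between[OF assms(2,1) lt] by auto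
    then have "ennreal w \<le> last_zero X \<omega>"
      unfolding last_zero_def using assms(1) by (intro SUP_upper) auto
    then have "ennreal w \<le> ennreal t" using assms(3) by (rule order_trans)
    then show False using w assms(1) by (simp add: ennreal_le_iff)
  qed
  then show ?thesis using assms by (auto simp: flat_forever_def)
qed

text \<open>There is a zero \<open>w > t\<close>, and by right-continuity \<open>X\<close> is small
  at rational times just after it. Choosing \<open>n\<close> beyond \<open>w\<close> strictly leaves
  room for such times before \<open>n\<close>.\<close>

lemma near_zero_of_late_zero:
  assumes "0 \<le> t" "\<omega> \<in> flat_forever t" "\<not> last_zero X \<omega> \<le> ennreal t"
  shows "\<exists>m. \<forall>n::nat. m \<le> n \<longrightarrow> t \<le> real n \<and> \<omega> \<in> near_zero t (real n)"
proof -
  have \<omega>: "\<omega> \<in> space P" using assms(2) by (auto simp: flat_forever_def)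
  obtain w where "0 \<le> w" "X w \<omega> = 0" "ennreal t < ennreal w"
    using assms(3) by (auto simp: last_zero_def not_le less_SUP_iff)
  then have w: "0 \<le> w" "X w \<omega> = 0" "t < w" using assms(1) by (auto simp: ennreal_less_iff)
  obtain m :: nat where m: "w < real m" using reals_Archimedean2 by blast
  show ?thesis
  proof (intro exI[of _ m] allI impI conjI)
    fix n assume n: "m \<le> n"
    then have wn: "w < real n" using m by simp
    then show tn: "t \<le> real n" using w by simp
    have "\<exists>u\<in>\<rat> \<inter> {t..real n}. X u \<omega> < 1 / real (Suc k)" for k
    proof -
      have "((\<lambda>v. X v \<omega>) \<longlongrightarrow> 0) (at_right w)" using X_right_cont[OF w(1) \<omega>] w(2) by simp
      from order_tendstoD(2)[OF this, of "1 / real (Suc k)"]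
      obtain b where b: "w < b" "\<And>v. w < v \<Longrightarrow> v < b \<Longrightarrow> X v \<omega> < 1 / real (Suc k)"
        by (auto simp: eventually_at_right_field)
      obtain q where q: "q \<in> \<rat>" "w < q" "q < min b (real n)"
        using Rats_dense_in_real[of w "min b (real n)"] b(1) wn by auto
      then show ?thesis using b(2)[of q] w by (intro bexI[of _ q]) auto
    qed
    then show "\<omega> \<in> near_zero t (real n)"
      using flat_forever_flat[OF assms(1) tn assms(2)] by (simp add: near_zero_def)
  qed
qed

end

subsection \<open>The measure represented by the submartingale\<close>

locale generated_class_Sigma_decomposition = class_Sigma_decomposition +
  assumes generated: "sets P = sigma_sets (space P) (\<Union>t\<in>{0..}. sets (F t))"
begin

text \<open>The union of a filtration is stable under intersection and generates. Times before
  \<open>s\<close> need no separate check, because their events also belong to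
  \<open>F s\<close>.\<close>

lemma measure_eq_on_filtration:
  assumes sets: "sets M = sets P" "sets M' = sets P" and "0 \<le> s" and fin: "emeasure M (space P) \<noteq> \<infinity>"
    and eq: "\<And>t B. s \<le> t \<Longrightarrow> B \<in> sets (F t) \<Longrightarrow> emeasure M B = emeasure M' B"
  shows "M = M'"
proof (rule measure_eqI_generator_eq[where E = "\<Union>t\<in>{0..}. sets (F t)" and \<Omega> = "space P" and A = "\<lambda>_. space P"])
  show "Int_stable (\<Union>t\<in>{0..}. sets (F t))"
  proof (rule Int_stableI)
    fix B C assume "B \<in> (\<Union>t\<in>{0..}. sets (F t))" "C \<in> (\<Union>t\<in>{0..}. sets (F t))"
    then obtain t u where tu: "0 \<le> t" "0 \<le> u" "B \<in> sets (F t)" "C \<in> sets (F u)" by auto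
    then have "B \<in> sets (F (max t u))" "C \<in> sets (F (max t u))"
      using F_mono[of t "max t u"] F_mono[of u "max t u"] by auto
    then show "B \<inter> C \<in> (\<Union>t\<in>{0..}. sets (F t))" using tu by (intro UN_I[of "max t u"]) auto
  qed
  show "(\<Union>t\<in>{0..}. sets (F t)) \<subseteq> Pow (space P)"
    using sets_F sets.sets_into_space by fastforce
  show "emeasure M B = emeasure M' B" if "B \<in> (\<Union>t\<in>{0..}. sets (F t))" for B
  proof -
    obtain t where t: "0 \<le> t" "B \<in> sets (F t)" using \<open>B \<in> _\<close> by auto
    then have "B \<in> sets (F (max s t))" using F_mono[of t "max s t"] by auto
    then show ?thesis by (intro eq[of "max s t"]) auto
  qed
  show "sets M = sigma_sets (space P) (\<Union>t\<in>{0..}. sets (F t))"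
    "sets M' = sigma_sets (space P) (\<Union>t\<in>{0..}. sets (F t))"
    using sets generated by simp_all
  have "space P \<in> sets (F 0)" using sets.top[of "F 0"] space_F[of 0] by simp
  then show "range (\<lambda>_. space P) \<subseteq> (\<Union>t\<in>{0..}. sets (F t))" by force
qed (use fin in auto)

text \<open>Conditions (i) and (ii) with the measurable event \<open>{A\<^sub>\<infinity> = A\<^sub>t}\<close> in place of \<open>{g \<le> t}\<close>, which is
  measurable only after completion.\<close>

definition represents :: "'a measure \<Rightarrow> bool" where
  "represents Q \<longleftrightarrow> sets Q = sets P \<and>
     (\<forall>t\<ge>0. \<forall>B\<in>sets (F t). emeasure Q (B \<inter> flat_forever t) = ennreal (\<integral>\<omega>. indicator B \<omega> * X t \<omega> \<partial>P)) \<and>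
     emeasure Q (space P - (\<Union>n. flat_forever (real n))) = 0"

text \<open>The prescription at time \<open>t\<close> for the event
  \<open>B \<inter> flat s t\<close> gives the values on \<open>flat_forever s\<close> for all later
  sigma-algebras, not just for \<open>F s\<close>.\<close>

lemma represents_flat:
  assumes Q: "represents Q" and "0 \<le> s" "s \<le> t" "B \<in> sets (F t)"
  shows "emeasure Q (B \<inter> flat_forever s) = emeasure (flat_measure s t) B"
proof -
  have "B \<inter> flat s t \<in> sets (F t)" using assms flat_sets by auto
  moreover have "B \<inter> flat_forever s = (B \<inter> flat s t) \<inter> flat_forever t"
    using flat_forever_split[OF assms(2,3)] by auto
  ultimately show ?thesis
    using Q assms sets_F[of t] by (auto simp: represents_def emeasure_flat_measure)
qed

text \<open>The total masses may be infinite, so the comparison is made on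
  \<open>flat_forever (real n)\<close>, where both measures are finite and prescribed on
  \<open>F t\<close> for all \<open>t \<ge> n\<close>. These sets increase to the whole space up to
  a null set.\<close>

lemma represents_unique:
  assumes Q: "represents Q" and Q': "represents Q'"
  shows "Q = Q'"
proof (rule measure_eqI)
  have sets: "sets Q = sets P" "sets Q' = sets P" using assms by (auto simp: represents_def)
  then show "sets Q = sets Q'" by simp
  have C: "flat_forever (real n) \<in> sets P" for n by (rule flat_forever_sets) simp
  have eq: "emeasure Q (B \<inter> flat_forever (real n)) = emeasure Q' (B \<inter> flat_forever (real n))"
    if B: "B \<in> sets P" for B n
  proof -
    have dens: "emeasure (density R (indicator (flat_forever (real n)))) B = emeasure R (B \<inter> flat_forever (real n))"
      if "sets R = sets P" "B \<in> sets P" for R B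
      using that C by (simp add: emeasure_restricted Int_commute)
    have "density Q (indicator (flat_forever (real n))) = density Q' (indicator (flat_forever (real n)))"
    proof (rule measure_eq_on_filtration[where s = "real n"])
      fix t B assume "real n \<le> t" "B \<in> sets (F t)"
      then show "emeasure (density Q (indicator (flat_forever (real n)))) B
          = emeasure (density Q' (indicator (flat_forever (real n)))) B"
        using represents_flat[OF Q, of "real n" t B] represents_flat[OF Q', of "real n" t B] sets_F[of t B]
        by (simp add: dens sets)
    next
      have "space P \<in> sets (F (real n))" using sets.top[of "F (real n)"] space_F[of "real n"] by simp
      then show "emeasure (density Q (indicator (flat_forever (real n)))) (space P) \<noteq> \<infinity>"
        using Q by (simp add: dens sets represents_def)
    qed (simp_all add: sets)
    then show ?thesis using dens[of Q B] dens[of Q' B] sets B by simp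
  qed
  have inc: "incseq (\<lambda>n. B \<inter> flat_forever (real n))" for B
  proof (rule incseq_SucI)
    fix n
    have "flat_forever (real n) \<subseteq> flat_forever (real (Suc n))"
      using flat_forever_split[of "real n" "real (Suc n)"] by simp
    then show "B \<inter> flat_forever (real n) \<subseteq> B \<inter> flat_forever (real (Suc n))" by blast
  qed
  have rep: "emeasure R B = (SUP n. emeasure R (B \<inter> flat_forever (real n)))"
    if R: "represents R" and B: "B \<in> sets P" for R B
  proof -
    have sR: "sets R = sets P" using R by (simp add: represents_def)
    have N: "space P - (\<Union>n. flat_forever (real n)) \<in> null_sets R"
      using R C by (auto simp: represents_def null_sets_def)
    have B_eq: "B = (\<Union>n. B \<inter> flat_forever (real n)) \<union> (B \<inter> (space P - (\<Union>n. flat_forever (real n))))"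
      using sets.sets_into_space[OF B] by auto
    have null: "B \<inter> (space P - (\<Union>n. flat_forever (real n))) \<in> null_sets R"
      by (rule null_set_Int1[OF N]) (use B sR in simp)
    have "emeasure R B = emeasure R ((\<Union>n. B \<inter> flat_forever (real n))
        \<union> (B \<inter> (space P - (\<Union>n. flat_forever (real n)))))"
      by (rule arg_cong[OF B_eq])
    also have "\<dots> = emeasure R (\<Union>n. B \<inter> flat_forever (real n))"
      by (rule emeasure_Un_null_set[OF _ null]) (use C B sR in auto)
    also have "\<dots> = (SUP n. emeasure R (B \<inter> flat_forever (real n)))"
      using C B sR inc by (intro SUP_emeasure_incseq[symmetric]) auto
    finally show ?thesis .
  qed
  fix B assume "B \<in> sets Q"
  then show "emeasure Q B = emeasure Q' B"
    using rep[OF Q] rep[OF Q'] eq sets by simp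
qed

lemma represents_exists:
  assumes sets: "\<And>n. sets (\<nu> n) = sets P"
    and \<nu>: "\<And>n t B. real n \<le> t \<Longrightarrow> B \<in> sets (F t) \<Longrightarrow> emeasure (\<nu> n) B = emeasure (flat_measure (real n) t) B"
  shows "\<exists>Q. represents Q"
proof -
  have C: "flat_forever t \<in> sets P" if "0 \<le> t" for t using flat_forever_sets[OF that] .
  have space\<nu>: "space (\<nu> n) = space P" for n using sets_eq_imp_space_eq[OF sets] .
  have top: "space P \<in> sets (F t)" if "0 \<le> t" for t using sets.top[of "F t"] space_F[OF that] by simp
  have fin: "finite_measure (\<nu> n)" for n
    by (rule finite_measureI) (simp add: space\<nu> \<nu>[OF order_refl top] emeasure_flat_measure)
  have \<nu>_forever: "emeasure (\<nu> n) (B \<inter> flat_forever s) = emeasure (flat_measure s t) B"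
    if st: "0 \<le> s" "s \<le> real n" "s \<le> t" and B: "B \<in> sets (F t)" for n s t B
  proof -
    interpret finite_measure "\<nu> n" by (rule fin)
    obtain k0 :: nat where k0: "max t (real n) \<le> real k0" using real_arch_simple by blast
    \<comment> \<open>Starting at \<open>k0\<close>, beyond both \<open>t\<close> and
      \<open>n\<close>, the value of \<open>\<nu> n\<close> on \<open>D j\<close> is given by the
      hypothesis. All \<open>D j\<close> turn out to have the same mass, and they decrease to
      \<open>B \<inter> flat_forever s\<close>; finiteness of \<open>\<nu> n\<close> allows the
      limit.\<close>
    define D where "D j = B \<inter> flat s (real (k0 + j))" for j
    have t0: "0 \<le> t" using st by simp
    have D: "D j \<in> sets (F (real (k0 + j)))" for j
      using F_mono[OF t0, of "real (k0 + j)"] flat_sets[OF st(1), of "real (k0 + j)"] k0 st B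
      by (auto simp: D_def)
    have DP: "D j \<in> sets P" for j using sets_F[OF _ D] by simp
    have BP: "B \<in> sets P" using sets_F[OF t0 B] .
    have D_val: "emeasure (\<nu> n) (D j) = emeasure (flat_measure s t) B" for j
    proof -
      let ?k = "real (k0 + j)"
      have k: "real n \<le> ?k" "t \<le> ?k" "s \<le> ?k" using k0 st by auto
      have "emeasure (\<nu> n) (D j) = emeasure (flat_measure (real n) ?k) (D j)" by (rule \<nu>[OF k(1) D])
      also have "\<dots> = emeasure (flat_measure s ?k) B"
        unfolding D_def by (rule flat_measure_Int_flat[OF st(1,2) k(1) BP])
      also have "\<dots> = emeasure (flat_measure s t) B"
        by (rule flat_measure_extends[OF st(1,3) k(2) B])
      finally show ?thesis .
    qed
    have "decseq D"
      unfolding decseq_def D_def using k0 st(3) by (intro allI impI Int_mono flat_subset[OF st(1)]) auto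
    then have "(\<lambda>j. emeasure (\<nu> n) (D j)) \<longlonglongrightarrow> emeasure (\<nu> n) (\<Inter>j. D j)"
      using DP sets by (intro Lim_emeasure_decseq) auto
    then have "emeasure (\<nu> n) (\<Inter>j. D j) = emeasure (flat_measure s t) B"
      unfolding D_val by (simp add: LIMSEQ_const_iff)
    moreover have "(\<Inter>j. D j) = B \<inter> flat_forever s"
    proof
      show "B \<inter> flat_forever s \<subseteq> (\<Inter>j. D j)"
        using flat_forever_flat[OF st(1)] k0 st(3) by (force simp: D_def)
      have "\<omega> \<in> flat_forever s" if \<omega>: "\<And>j. \<omega> \<in> flat s (real (k0 + j))" for \<omega>
      proof -
        have "\<omega> \<in> flat s (real k)" if "s \<le> real k" for k
          using flat_subset[OF st(1) that, of "real (k0 + k)"] \<omega>[of k] by auto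
        then show ?thesis using \<omega>[of 0] by (auto simp: flat_forever_def flat_def)
      qed
      then show "(\<Inter>j. D j) \<subseteq> B \<inter> flat_forever s" by (auto simp: D_def)
    qed
    ultimately show ?thesis by simp
  qed
  \<comment> \<open>For \<open>n \<le> m\<close>, \<open>\<nu> n\<close> is the restriction of
    \<open>\<nu> m\<close> to \<open>flat_forever (real n)\<close>: the two agree on
    \<open>F t\<close> for all \<open>t \<ge> m\<close>.\<close>
  have mono: "\<nu> n \<le> \<nu> m" if "n \<le> m" for n m
  proof -
    have "density (\<nu> m) (indicator (flat_forever (real n))) = \<nu> n"
    proof (rule measure_eq_on_filtration[where s = "real m"])
      have dens: "emeasure (density (\<nu> m) (indicator (flat_forever (real n)))) B = emeasure (\<nu> m) (B \<inter> flat_forever (real n))"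
        if "B \<in> sets P" for B
        using that C[of "real n"] sets by (simp add: emeasure_restricted Int_commute)
      show "emeasure (density (\<nu> m) (indicator (flat_forever (real n)))) (space P) \<noteq> \<infinity>"
        using finite_measure.emeasure_finite[OF fin] by (simp add: dens)
      fix t B assume "real m \<le> t" "B \<in> sets (F t)"
      then show "emeasure (density (\<nu> m) (indicator (flat_forever (real n)))) B = emeasure (\<nu> n) B"
        using \<nu>_forever[of "real n" m t B] \<nu>[of n t B] sets_F[of t B] that by (simp add: dens)
    qed (simp_all add: sets)
    moreover have "emeasure (density (\<nu> m) (indicator (flat_forever (real n)))) B \<le> emeasure (\<nu> m) B"
      if "B \<in> sets P" for B
      using that C[of "real n"] sets by (simp add: emeasure_restricted emeasure_mono)
    ultimately show ?thesis
      by (subst le_measure) (auto simp: sets)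
  qed
  define Q where "Q = (SUP n. \<nu> n)"
  have sets_Q: "sets Q = sets P"
    unfolding Q_def by (rule sets_SUP) (auto simp: sets)
  have Q: "emeasure Q B = (SUP n. emeasure (\<nu> n) B)" if "B \<in> sets P" for B
    unfolding Q_def
  proof (rule emeasure_SUP_chain[where N = P])
    show "Complete_Partial_Order.chain (\<le>) (range \<nu>)"
      unfolding Complete_Partial_Order.chain_def using mono nat_le_linear by blast
  qed (auto simp: sets that)
  have \<nu>_mono: "emeasure (\<nu> n) B \<le> emeasure (\<nu> m) B" if "n \<le> m" for n m B
    by (rule le_measureD3[OF mono[OF that]]) (simp add: sets)
  have "emeasure Q (B \<inter> flat_forever t) = ennreal (\<integral>\<omega>. indicator B \<omega> * X t \<omega> \<partial>P)"
    if t: "0 \<le> t" and B: "B \<in> sets (F t)" for t B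
  proof -
    have BP: "B \<in> sets P" using sets_F[OF t B] .
    obtain n0 :: nat where n0: "t \<le> real n0" using real_arch_simple by blast
    \<comment> \<open>On subsets of this form the increasing sequence of measures is constant from
      \<open>n0\<close> on, so its supremum has the prescribed value.\<close>
    have eq: "emeasure (\<nu> n) (B \<inter> flat_forever t) = ennreal (\<integral>\<omega>. indicator B \<omega> * X t \<omega> \<partial>P)"
      if "n0 \<le> n" for n
      using \<nu>_forever[OF t _ order_refl B, of n] that n0 emeasure_flat_measure_refl[OF t BP] by simp
    have "emeasure Q (B \<inter> flat_forever t) = (SUP n. emeasure (\<nu> n) (B \<inter> flat_forever t))"
      using Q BP C[OF t] by simp
    also have "\<dots> = emeasure (\<nu> n0) (B \<inter> flat_forever t)"
    proof (intro antisym SUP_least SUP_upper UNIV_I)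
      fix n
      show "emeasure (\<nu> n) (B \<inter> flat_forever t) \<le> emeasure (\<nu> n0) (B \<inter> flat_forever t)"
        using \<nu>_mono[of n "max n n0" "B \<inter> flat_forever t"] eq[of n0] eq[of "max n n0"] by simp
    qed
    finally show ?thesis using eq by simp
  qed
  moreover have "emeasure Q (space P - (\<Union>n. flat_forever (real n))) = 0"
  proof -
    \<comment> \<open>\<open>\<nu> n\<close> gives \<open>flat_forever (real n)\<close> its full,
      finite mass, so the complement is null.\<close>
    have "emeasure (\<nu> n) (space P - (\<Union>n. flat_forever (real n))) = 0" for n
    proof -
      interpret finite_measure "\<nu> n" by (rule fin)
      have Cn: "flat_forever (real n) \<in> sets P" by (rule C) simp
      have "emeasure (\<nu> n) (flat_forever (real n)) = emeasure (\<nu> n) (space P)"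
        using \<nu>_forever[OF _ order_refl order_refl top, of n] \<nu>[OF order_refl top, of n] sets.sets_into_space[OF Cn]
        by (simp add: Int_absorb1)
      then have "emeasure (\<nu> n) (space (\<nu> n) - flat_forever (real n)) = 0"
        using Cn sets emeasure_finite by (subst emeasure_compl) (auto simp: space\<nu>)
      moreover have "emeasure (\<nu> n) (space P - (\<Union>n. flat_forever (real n)))
          \<le> emeasure (\<nu> n) (space (\<nu> n) - flat_forever (real n))"
        using Cn sets by (intro emeasure_mono) (auto simp: space\<nu>)
      ultimately show ?thesis by simp
    qed
    moreover have "space P - (\<Union>n. flat_forever (real n)) \<in> sets P" using C by auto
    ultimately show ?thesis using Q by simp
  qed
  ultimately have "represents Q" using sets_Q by (simp add: represents_def)
  then show ?thesis ..
qed

section \<open>The null difference between \<open>{A\<^sub>\<infinity> = A\<^sub>t}\<close> and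
  \<open>{g \<le> t}\<close>\<close>

definition late_zero :: "real \<Rightarrow> 'a set" where
  "late_zero t = {\<omega> \<in> flat_forever t. \<not> last_zero X \<omega> \<le> ennreal t}"

lemma last_zero_le_eq:
  assumes "0 \<le> t"
  shows "{\<omega> \<in> space P. last_zero X \<omega> \<le> ennreal t} = flat_forever t - late_zero t"
  using flat_forever_of_last_zero_le[OF assms] by (auto simp: late_zero_def flat_forever_def)

text \<open>A late zero puts the path into \<open>near_zero t (real n)\<close> for some
  \<open>n\<close>. On \<open>flat_forever t\<close> the measure \<open>Q\<close> coincides on
  \<open>F n\<close> with \<open>flat_measure t n\<close>, for which that event is null. Only the
  covering events are known to be measurable, hence the completion.\<close>

lemma late_zero_null:
  assumes Q: "represents Q" and t: "0 \<le> t"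
  shows "late_zero t \<in> null_sets (completion Q)"
proof (rule null_sets_completion_subset)
  show "late_zero t \<subseteq> (\<Union>n\<in>{n. t \<le> real n}. near_zero t (real n) \<inter> flat_forever t)"
  proof
    fix \<omega> assume "\<omega> \<in> late_zero t"
    then have "\<omega> \<in> flat_forever t" "\<not> last_zero X \<omega> \<le> ennreal t" by (auto simp: late_zero_def)
    then show "\<omega> \<in> (\<Union>n\<in>{n. t \<le> real n}. near_zero t (real n) \<inter> flat_forever t)"
      using near_zero_of_late_zero[OF t] by blast
  qed
  have "near_zero t (real n) \<inter> flat_forever t \<in> null_sets Q" if n: "t \<le> real n" for n
  proof (rule null_setsI)
    show "emeasure Q (near_zero t (real n) \<inter> flat_forever t) = 0"
      using represents_flat[OF Q t n near_zero_sets[OF t n]] near_zero_null[OF t n] by simp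
    show "near_zero t (real n) \<inter> flat_forever t \<in> sets Q"
      using sets_F[OF _ near_zero_sets[OF t n]] flat_forever_sets[OF t] Q by (auto simp: represents_def)
  qed
  then have "(\<Union>n\<in>{n. t \<le> real n}. near_zero t (real n) \<inter> flat_forever t) \<in> null_sets Q"
    by (intro null_sets_UN') auto
  then show "(\<Union>n\<in>{n. t \<le> real n}. near_zero t (real n) \<inter> flat_forever t) \<in> null_sets (completion Q)"
    by (rule null_sets_completionI)
qed

lemma represents_sigma_finite:
  assumes Q: "represents Q"
  shows "sigma_finite_measure Q"
proof
  have sets: "sets Q = sets P" using Q by (simp add: represents_def)
  have C: "flat_forever (real n) \<in> sets P" for n by (rule flat_forever_sets) simp
  have "emeasure Q (flat_forever (real n)) \<noteq> \<infinity>" for n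
  proof -
    have "space P \<in> sets (F (real n))" using sets.top[of "F (real n)"] space_F[of "real n"] by simp
    then have "emeasure Q (space P \<inter> flat_forever (real n)) = ennreal (\<integral>\<omega>. indicator (space P) \<omega> * X (real n) \<omega> \<partial>P)"
      using Q by (simp add: represents_def)
    then show ?thesis using sets.sets_into_space[OF C[of n]] by (simp add: Int_absorb1)
  qed
  then show "\<exists>A. countable A \<and> A \<subseteq> sets Q \<and> \<Union>A = space Q \<and> (\<forall>a\<in>A. emeasure Q a \<noteq> \<infinity>)"
    using Q C sets.sets_into_space[OF C] sets_eq_imp_space_eq[OF sets]
    by (intro exI[of _ "insert (space P - (\<Union>n. flat_forever (real n))) (range (\<lambda>n. flat_forever (real n)))"])
      (auto simp: represents_def)
qed

text \<open>Outside a null set the path lies in some \<open>flat_forever (real n)\<close>; if g is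
  infinite, it then has a zero after \<open>n\<close>.\<close>

lemma represents_last_zero_infinite:
  assumes Q: "represents Q"
  shows "{\<omega> \<in> space Q. last_zero X \<omega> = \<infinity>} \<in> null_sets (completion Q)"
proof (rule null_sets_completion_subset)
  have sets: "sets Q = sets P" using Q by (simp add: represents_def)
  show "{\<omega> \<in> space Q. last_zero X \<omega> = \<infinity>}
      \<subseteq> (space P - (\<Union>n. flat_forever (real n))) \<union> (\<Union>n. late_zero (real n))"
    using sets_eq_imp_space_eq[OF sets] by (auto simp: late_zero_def top_unique)
  have "(\<Union>n. flat_forever (real n)) \<in> sets P" using flat_forever_sets by auto
  then have "space P - (\<Union>n. flat_forever (real n)) \<in> null_sets Q"
    using Q by (auto simp: represents_def)
  then show "(space P - (\<Union>n. flat_forever (real n))) \<union> (\<Union>n. late_zero (real n)) \<in> null_sets (completion Q)"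
    using late_zero_null[OF Q] by (intro null_sets.Un[OF null_sets_completionI] null_sets_UN) auto
qed

text \<open>Passage from events to bounded functions. Restricted to \<open>flat_forever t\<close>,
  \<open>Q\<close> has the same values as the measure with density \<open>X t\<close>, but only on
  \<open>F t\<close>; therefore both are restricted to \<open>F t\<close> before integrals are
  compared.\<close>

lemma represents_integral:
  assumes Q: "represents Q" and t: "0 \<le> t"
    and f: "f \<in> borel_measurable (F t)" "bounded (f ` space P)"
  shows "integrable Q (\<lambda>\<omega>. f \<omega> * indicator (flat_forever t) \<omega> :: real)"
    and "(\<integral>\<omega>. f \<omega> * indicator (flat_forever t) \<omega> \<partial>Q) = (\<integral>\<omega>. f \<omega> * X t \<omega> \<partial>P)"
proof -
  have sets: "sets Q = sets P" using Q by (simp add: represents_def)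
  note space = sets_eq_imp_space_eq[OF sets]
  have C: "flat_forever t \<in> sets Q" using flat_forever_sets[OF t] sets by simp
  have fP: "f \<in> borel_measurable P" by (rule measurable_from_subalg[OF subalg[OF t] f(1)])
  then have fQ: "f \<in> borel_measurable Q" using sets by (simp cong: measurable_cong_sets)
  obtain b where b: "\<And>\<omega>. \<omega> \<in> space P \<Longrightarrow> \<bar>f \<omega>\<bar> \<le> b"
    using f(2) by (auto simp: bounded_iff)
  define D where "D = density Q (\<lambda>\<omega>. ennreal (indicator (flat_forever t) \<omega>))"
  have D: "emeasure D B = emeasure Q (B \<inter> flat_forever t)" if "B \<in> sets P" for B
    using that C sets by (simp add: D_def emeasure_restricted Int_commute ennreal_indicator)
  have sets_D: "sets D = sets P" "space D = space P" by (simp_all add: D_def sets space)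
  have sub: "subalgebra D (F t)" "subalgebra (flat_measure t t) (F t)"
    using subalg[OF t] by (auto simp: subalgebra_def sets_D)
  have eq: "restr_to_subalg D (F t) = restr_to_subalg (flat_measure t t) (F t)"
  proof (rule measure_eqI)
    show "sets (restr_to_subalg D (F t)) = sets (restr_to_subalg (flat_measure t t) (F t))"
      by (simp add: sets_restr_to_subalg sub)
    fix B assume "B \<in> sets (restr_to_subalg D (F t))"
    then have B: "B \<in> sets (F t)" by (simp add: sets_restr_to_subalg sub)
    then show "emeasure (restr_to_subalg D (F t)) B = emeasure (restr_to_subalg (flat_measure t t) (F t)) B"
      using Q t sets_F[OF t B]
      by (simp add: emeasure_restr_to_subalg sub D emeasure_flat_measure_refl represents_def)
  qed
  have "emeasure D (space P) < \<infinity>"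
  proof -
    have "space P \<in> sets (F t)" using sets.top[of "F t"] space_F[OF t] by simp
    then show ?thesis using Q t by (simp add: D represents_def)
  qed
  then interpret D: finite_measure D by (intro finite_measureI) (auto simp: sets_D)
  have fD: "f \<in> borel_measurable D" using fP sets_D by (simp cong: measurable_cong_sets)
  have "integrable D f"
    using b fD by (intro D.integrable_const_bound[where B = b] AE_I2) (auto simp: sets_D)
  then show "integrable Q (\<lambda>\<omega>. f \<omega> * indicator (flat_forever t) \<omega>)"
    using C fQ unfolding D_def by (subst (asm) integrable_density) (auto simp: mult.commute)
  have "(\<integral>\<omega>. f \<omega> * indicator (flat_forever t) \<omega> \<partial>Q) = (\<integral>\<omega>. f \<omega> \<partial>D)"
    using C fQ unfolding D_def by (subst integral_density) (auto simp: mult.commute)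
  also have "\<dots> = (\<integral>\<omega>. f \<omega> \<partial>flat_measure t t)"
    using integral_subalgebra2[OF sub(1) f(1)] integral_subalgebra2[OF sub(2) f(1)] by (simp add: eq)
  also have "\<dots> = (\<integral>\<omega>. f \<omega> * X t \<omega> \<partial>P)"
  proof -
    have [measurable]: "X t \<in> borel_measurable P" "space P \<in> sets P" using measurable_P t by auto
    have "(\<integral>\<omega>. f \<omega> \<partial>flat_measure t t) = (\<integral>\<omega>. (indicator (flat t t) \<omega> * X t \<omega>) *\<^sub>R f \<omega> \<partial>P)"
      unfolding flat_measure_def flat_refl using fP X_nonneg[OF t] by (intro integral_density AE_I2) auto
    also have "\<dots> = (\<integral>\<omega>. f \<omega> * X t \<omega> \<partial>P)"
      by (intro Bochner_Integration.integral_cong) (auto simp: flat_refl)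
    finally show ?thesis .
  qed
  finally show "(\<integral>\<omega>. f \<omega> * indicator (flat_forever t) \<omega> \<partial>Q) = (\<integral>\<omega>. f \<omega> * X t \<omega> \<partial>P)" .
qed

text \<open>The integrands with \<open>flat_forever t\<close> and with \<open>{g \<le> t}\<close>
  differ only on \<open>late_zero t\<close>, which is null in the completion.\<close>

lemma represents_last_zero_integral:
  assumes Q: "represents Q" and t: "0 \<le> t"
    and f: "f \<in> borel_measurable (F t)" "bounded (f ` space P)"
  shows "integrable (completion Q) (\<lambda>\<omega>. f \<omega> * indicator {\<omega>. last_zero X \<omega> \<le> ennreal t} \<omega> :: real)"
    and "(\<integral>\<omega>. f \<omega> * indicator {\<omega>. last_zero X \<omega> \<le> ennreal t} \<omega> \<partial>completion Q) = (\<integral>\<omega>. f \<omega> * X t \<omega> \<partial>P)"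
proof -
  have sets: "sets Q = sets P" using Q by (simp add: represents_def)
  note space = sets_eq_imp_space_eq[OF sets]
  have C: "flat_forever t \<in> sets Q" using flat_forever_sets[OF t] sets by simp
  have "f \<in> borel_measurable P" by (rule measurable_from_subalg[OF subalg[OF t] f(1)])
  then have fQ: "f \<in> borel_measurable Q" using sets by (simp cong: measurable_cong_sets)
  note late = late_zero_null[OF Q t]
  let ?g = "\<lambda>\<omega>. f \<omega> * indicator (flat_forever t) \<omega>"
  let ?h = "\<lambda>\<omega>. f \<omega> * indicator {\<omega>. last_zero X \<omega> \<le> ennreal t} \<omega>"
  have gQ: "?g \<in> borel_measurable Q" using fQ C by measurable
  have eq: "?h \<omega> = f \<omega> * indicator (flat_forever t - late_zero t) \<omega>" if "\<omega> \<in> space P" for \<omega>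
    using that last_zero_le_eq[OF t] by (auto simp: indicator_def)
  have "flat_forever t - late_zero t \<in> sets (completion Q)"
    using C late by (intro sets.Diff) auto
  then have "(\<lambda>\<omega>. f \<omega> * indicator (flat_forever t - late_zero t) \<omega>) \<in> borel_measurable (completion Q)"
    using measurable_completion[OF fQ] by measurable
  then have h: "?h \<in> borel_measurable (completion Q)"
    using eq by (subst measurable_cong[where g = "\<lambda>\<omega>. f \<omega> * indicator (flat_forever t - late_zero t) \<omega>"]) (auto simp: space)
  have ae: "AE \<omega> in completion Q. ?g \<omega> = ?h \<omega>"
  proof (rule AE_I'[OF late])
    show "{\<omega> \<in> space (completion Q). ?g \<omega> \<noteq> ?h \<omega>} \<subseteq> late_zero t"
      using flat_forever_of_last_zero_le[OF t] by (auto simp: space indicator_def late_zero_def)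
  qed
  have int: "integrable (completion Q) ?g"
    using represents_integral(1)[OF assms] gQ by (simp add: integrable_completion)
  show "integrable (completion Q) ?h"
    using integrable_cong_AE[OF measurable_completion[OF gQ] h ae] int by simp
  have "(\<integral>\<omega>. ?h \<omega> \<partial>completion Q) = (\<integral>\<omega>. ?g \<omega> \<partial>completion Q)"
    by (rule integral_cong_AE[OF measurable_completion[OF gQ] h ae, symmetric])
  also have "\<dots> = (\<integral>\<omega>. f \<omega> * X t \<omega> \<partial>P)"
    using represents_integral(2)[OF assms] gQ by (simp add: integral_completion)
  finally show "(\<integral>\<omega>. ?h \<omega> \<partial>completion Q) = (\<integral>\<omega>. f \<omega> * X t \<omega> \<partial>P)" .
qed

text \<open>Here the nullity of \<open>late_zero t\<close> has to come from conditions (i) and (ii)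
  alone. Since g is almost everywhere finite, a path with a late zero satisfies g \<le> n and lies
  in \<open>near_zero t n\<close> for some \<open>n\<close>, and (ii) at time \<open>n\<close> shows
  that this intersection is null.\<close>

lemma representsI:
  assumes sets: "sets Q = sets P"
    and inf: "{\<omega> \<in> space Q. last_zero X \<omega> = \<infinity>} \<in> null_sets (completion Q)"
    and int: "\<And>t B. 0 \<le> t \<Longrightarrow> B \<in> sets (F t) \<Longrightarrow>
      integrable (completion Q) (\<lambda>\<omega>. indicator B \<omega> * indicator {\<omega>. last_zero X \<omega> \<le> ennreal t} \<omega> :: real)"
    and val: "\<And>t B. 0 \<le> t \<Longrightarrow> B \<in> sets (F t) \<Longrightarrow>
      (\<integral>\<omega>. indicator B \<omega> * indicator {\<omega>. last_zero X \<omega> \<le> ennreal t} \<omega> \<partial>completion Q)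
        = (\<integral>\<omega>. indicator B \<omega> * X t \<omega> \<partial>P)"
  shows "represents Q"
proof -
  note space = sets_eq_imp_space_eq[OF sets]
  define S where "S t B = {\<omega> \<in> B. last_zero X \<omega> \<le> ennreal t}" for t B
  have S: "S t B \<in> sets (completion Q)"
    "emeasure (completion Q) (S t B) = ennreal (\<integral>\<omega>. indicator B \<omega> * X t \<omega> \<partial>P)"
    if t: "0 \<le> t" and B: "B \<in> sets (F t)" for t B
  proof -
    have ind: "indicator B \<omega> * indicator {\<omega>. last_zero X \<omega> \<le> ennreal t} \<omega> = (indicator (S t B) \<omega> :: real)" for \<omega>
      by (auto simp: S_def indicator_def)
    have "S t B \<subseteq> space Q" using sets.sets_into_space[OF sets_F[OF t B]] by (auto simp: S_def space)
    then have sp: "S t B \<inter> space (completion Q) = S t B" by auto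
    \<comment> \<open>Integrability supplies measurability and finite mass of \<open>S t B\<close>.
      The equation between integrals alone would not do, as the Bochner integral of a non-integrable
      function is 0 by default.\<close>
    have "integrable (completion Q) (indicator (S t B) :: 'a \<Rightarrow> real)"
      using int[OF t B] unfolding ind .
    then have *: "S t B \<in> sets (completion Q)" "emeasure (completion Q) (S t B) < \<infinity>"
      unfolding integrable_indicator_iff sp by auto
    then show "S t B \<in> sets (completion Q)" by simp
    have "measure (completion Q) (S t B) = (\<integral>\<omega>. indicator B \<omega> * X t \<omega> \<partial>P)"
      using val[OF t B] unfolding ind using sp by simp
    then show "emeasure (completion Q) (S t B) = ennreal (\<integral>\<omega>. indicator B \<omega> * X t \<omega> \<partial>P)"
      using * by (subst emeasure_eq_ennreal_measure) auto
  qed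
  have late: "late_zero t \<in> null_sets (completion Q)" if t: "0 \<le> t" for t
  proof (rule null_sets_completion_subset)
    show "late_zero t \<subseteq> {\<omega> \<in> space Q. last_zero X \<omega> = \<infinity>}
        \<union> (\<Union>n\<in>{n. t \<le> real n}. S (real n) (near_zero t (real n)))"
    proof
      fix \<omega> assume \<omega>: "\<omega> \<in> late_zero t"
      then obtain m where m: "\<And>n. m \<le> n \<Longrightarrow> t \<le> real n \<and> \<omega> \<in> near_zero t (real n)"
        using near_zero_of_late_zero[OF t] by (auto simp: late_zero_def)
      show "\<omega> \<in> {\<omega> \<in> space Q. last_zero X \<omega> = \<infinity>}
        \<union> (\<Union>n\<in>{n. t \<le> real n}. S (real n) (near_zero t (real n)))"
      proof (cases "last_zero X \<omega> = \<infinity>")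
        case True
        then show ?thesis using \<omega> by (auto simp: late_zero_def flat_forever_def space)
      next
        case False
        \<comment> \<open>Integers from \<open>k\<close> on bound g and integers from
          \<open>m\<close> on place \<open>\<omega>\<close> in \<open>near_zero\<close>;
          \<open>max k m\<close> does both.\<close>
        then obtain k :: nat where k: "last_zero X \<omega> < of_nat k"
          using ennreal_Ex_less_of_nat[of "last_zero X \<omega>"] by (auto simp: less_top)
        have "last_zero X \<omega> \<le> ennreal (real k)"
          using k by (simp add: ennreal_of_nat_eq_real_of_nat)
        also have "\<dots> \<le> ennreal (real (max k m))" by (intro ennreal_leI) simp
        finally have "\<omega> \<in> S (real (max k m)) (near_zero t (real (max k m)))"
          using m[of "max k m"] by (simp add: S_def)
        moreover have "t \<le> real (max k m)" using m[of "max k m"] by simp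
        ultimately show ?thesis by (intro UnI2 UN_I[of "max k m"]) simp_all
      qed
    qed
    \<comment> \<open>Condition (ii) gives this set the P-integral of \<open>X n\<close> over
      \<open>near_zero t n\<close>. As \<open>near_zero t n\<close> is part of
      \<open>flat t n\<close>, this is its mass under \<open>flat_measure t n\<close>, which is
      0.\<close>
    have "S (real n) (near_zero t (real n)) \<in> null_sets (completion Q)" if n: "t \<le> real n" for n
    proof (rule null_setsI)
      have nz: "near_zero t (real n) \<in> sets (F (real n))" by (rule near_zero_sets[OF t n])
      show "S (real n) (near_zero t (real n)) \<in> sets (completion Q)" by (rule S(1)[OF _ nz]) simp
      have "near_zero t (real n) \<inter> flat t (real n) = near_zero t (real n)" by (auto simp: near_zero_def)
      then show "emeasure (completion Q) (S (real n) (near_zero t (real n))) = 0"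
        using S(2)[OF _ nz] near_zero_null[OF t n] emeasure_flat_measure[OF t n sets_F[OF _ nz]] by simp
    qed
    then show "{\<omega> \<in> space Q. last_zero X \<omega> = \<infinity>} \<union> (\<Union>n\<in>{n. t \<le> real n}. S (real n) (near_zero t (real n)))
        \<in> null_sets (completion Q)"
      using inf by (intro null_sets.Un null_sets_UN') auto
  qed
  have "emeasure Q (B \<inter> flat_forever t) = ennreal (\<integral>\<omega>. indicator B \<omega> * X t \<omega> \<partial>P)"
    if t: "0 \<le> t" and B: "B \<in> sets (F t)" for t B
  proof -
    have BP: "B \<in> sets Q" "flat_forever t \<in> sets Q"
      using sets_F[OF t B] flat_forever_sets[OF t] sets by auto
    have "B \<inter> flat_forever t = S t B \<union> (B \<inter> late_zero t)"
      using last_zero_le_eq[OF t] sets.sets_into_space[OF sets_F[OF t B]]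
      by (auto simp: S_def late_zero_def)
    moreover have "B \<inter> late_zero t \<in> null_sets (completion Q)"
      using late[OF t] BP by (intro null_set_Int1) auto
    ultimately have "emeasure (completion Q) (B \<inter> flat_forever t) = emeasure (completion Q) (S t B)"
      using S(1)[OF t B] by (simp add: emeasure_Un_null_set)
    then show ?thesis using S(2)[OF t B] BP by simp
  qed
  moreover have "emeasure Q (space P - (\<Union>n. flat_forever (real n))) = 0"
  proof -
    \<comment> \<open>If g were at most some integer \<open>k\<close>, then \<open>A\<close> would
      be constant from \<open>k\<close> on.\<close>
    have "space P - (\<Union>n. flat_forever (real n)) \<subseteq> {\<omega> \<in> space Q. last_zero X \<omega> = \<infinity>}"
    proof
      fix \<omega> assume \<omega>: "\<omega> \<in> space P - (\<Union>n. flat_forever (real n))"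
      have "last_zero X \<omega> = \<infinity>"
      proof (rule ccontr)
        assume "last_zero X \<omega> \<noteq> \<infinity>"
        then obtain k :: nat where "last_zero X \<omega> < of_nat k"
          using ennreal_Ex_less_of_nat[of "last_zero X \<omega>"] by (auto simp: less_top)
        then have "last_zero X \<omega> \<le> ennreal (real k)" by (simp add: ennreal_of_nat_eq_real_of_nat)
        then show False using flat_forever_of_last_zero_le[of "real k" \<omega>] \<omega> by auto
      qed
      then show "\<omega> \<in> {\<omega> \<in> space Q. last_zero X \<omega> = \<infinity>}" using \<omega> by (simp add: space)
    qed
    then have "space P - (\<Union>n. flat_forever (real n)) \<in> null_sets (completion Q)"
      using inf by (rule null_sets_completion_subset)
    moreover have "space P - (\<Union>n. flat_forever (real n)) \<in> sets Q"
      using flat_forever_sets sets by auto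
    ultimately show ?thesis by (auto simp: null_sets_def)
  qed
  ultimately show ?thesis using sets by (simp add: represents_def)
qed

end

section \<open>From class (Sigma) and property (P) to the locales\<close>

lemma zero_between_of_stieltjes:
  assumes "continuous_on {0..} a" "mono_on {0..} a"
    and ae: "AE t in stieltjes_halfline a. t \<in> Z" and "0 \<le> u" "u < v" "a u < a v"
  shows "\<exists>w\<in>Z. u < w \<and> w \<le> v"
proof (rule ccontr)
  assume none: "\<not> ?thesis"
  let ?a = "\<lambda>t. a (max 0 t)"
  have cont: "continuous_on UNIV ?a"
    by (rule continuous_on_compose2[OF assms(1)]) (auto intro!: continuous_intros)
  \<comment> \<open>The interval has positive mass \<open>a v - a u\<close>; were it disjoint from
    the carrier \<open>Z\<close>, it would be a null set.\<close>
  have "emeasure (interval_measure ?a) {u<..v} = ennreal (?a v - ?a u)"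
  proof (rule emeasure_interval_measure_Ioc)
    show "?a x \<le> ?a y" if "x \<le> y" for x y
      using assms(2) that by (auto simp: mono_on_def)
    show "continuous (at_right x) ?a" for x
      using cont by (metis UNIV_I continuous_on_eq_continuous_within continuous_within_subset subset_UNIV)
  qed (use assms in simp)
  then have "emeasure (interval_measure ?a) {u<..v} \<noteq> 0"
    using assms by (simp add: max_def)
  moreover have "{u<..v} \<in> null_sets (interval_measure ?a)"
  proof (rule AE_iff_null_sets[THEN iffD2])
    show "AE t in interval_measure ?a. t \<notin> {u<..v}"
      using ae none unfolding stieltjes_halfline_def by (elim AE_mp) (auto intro!: AE_I2)
  qed simp
  ultimately show False by auto
qed

lemma property_P_generated:
  assumes "property_P P F"
  shows "filtration_on_halfline (space P) F" "sets P = sigma_sets (space P) (\<Union>t\<in>{0..}. sets (F t))"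
  using assms by (simp_all add: property_P_def)

lemma property_P_subalgebra:
  assumes "property_P P F" "0 \<le> t"
  shows "subalgebra P (F t)"
proof -
  note P = property_P_generated[OF assms(1)]
  have "sets (F t) \<subseteq> sets P"
    unfolding P(2) using assms(2) by (intro order_trans[OF _ sigma_sets_superset_generator]) auto
  then show ?thesis
    using P(1) assms(2) by (simp add: subalgebra_def filtration_on_halfline_iff)
qed

lemma class_Sigma_decomposition_exists:
  assumes P: "prob_space P" "property_P P F" and X: "class_Sigma P F X"
  shows "\<exists>N A. generated_class_Sigma_decomposition P F N A X"
proof -
  interpret prob_space P by (rule P(1))
  note gen = property_P_generated[OF P(2)] and sub = property_P_subalgebra[OF P(2)]
  from X obtain N A where
    Xs: "submartingale P F X" "\<And>t \<omega>. 0 \<le> t \<Longrightarrow> \<omega> \<in> space P \<Longrightarrow> 0 \<le> X t \<omega>"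
    and ad: "adapted F N" "adapted F A"
    and X_eq: "\<And>t \<omega>. 0 \<le> t \<Longrightarrow> \<omega> \<in> space P \<Longrightarrow> X t \<omega> = N t \<omega> + A t \<omega>"
    and N: "martingale P F N" "\<And>\<omega>. \<omega> \<in> space P \<Longrightarrow> cadlag (\<lambda>t. N t \<omega>)"
    and A: "\<And>\<omega>. \<omega> \<in> space P \<Longrightarrow> continuous_on {0..} (\<lambda>t. A t \<omega>)"
      "\<And>\<omega>. \<omega> \<in> space P \<Longrightarrow> mono_on {0..} (\<lambda>t. A t \<omega>)"
      "\<And>\<omega>. \<omega> \<in> space P \<Longrightarrow> AE t in stieltjes_halfline (\<lambda>t. A t \<omega>). t \<in> {t. 0 \<le> t \<and> X t \<omega> = 0}"
    unfolding class_Sigma_def by blast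
  have "generated_class_Sigma_decomposition P F N A X"
  proof
    show "subalgebra P (F t)" if "0 \<le> t" for t using sub[OF that] .
    show "sets (F s) \<subseteq> sets (F t)" if "0 \<le> s" "s \<le> t" for s t
      using gen(1) that by (auto simp: filtration_on_halfline_iff)
    show "X t \<in> borel_measurable (F t)" "integrable P (X t)" if "0 \<le> t" for t
      using Xs(1) that by (auto simp: submartingale_def adapted_def)
    show "A t \<in> borel_measurable (F t)" "integrable P (N t)" if "0 \<le> t" for t
      using N(1) ad that by (auto simp: martingale_def adapted_def)
    show "X t \<omega> = N t \<omega> + A t \<omega>" "0 \<le> X t \<omega>" if "0 \<le> t" "\<omega> \<in> space P" for t \<omega>
      using X_eq Xs(2) that by auto
    show "(\<integral>\<omega>. indicator B \<omega> * N t \<omega> \<partial>P) = (\<integral>\<omega>. indicator B \<omega> * N s \<omega> \<partial>P)"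
      if st: "0 \<le> s" "s \<le> t" and B: "B \<in> sets (F s)" for s t B
    proof -
      interpret finite_measure_subalgebra P "F s"
        by unfold_locales (rule sub[OF st(1)])
      have BP: "B \<in> sets P" using B subalg by (auto simp: subalgebra_def)
      have int: "integrable P (N t)" "integrable P (N s)" using N(1) st by (auto simp: martingale_def)
      have "(\<integral>\<omega>. indicator B \<omega> * N t \<omega> \<partial>P) = (\<integral>\<omega>. indicator B \<omega> * real_cond_exp P (F s) (N t) \<omega> \<partial>P)"
        using int B integrable_mult_indicator[OF BP int(1)]
        by (intro real_cond_exp_intg(2)[symmetric]) auto
      also have "\<dots> = (\<integral>\<omega>. indicator B \<omega> * N s \<omega> \<partial>P)"
      proof (rule integral_cong_AE)
        have "AE \<omega> in P. real_cond_exp P (F s) (N t) \<omega> = N s \<omega>"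
          using N(1) st unfolding martingale_def by blast
        then show "AE \<omega> in P. indicator B \<omega> * real_cond_exp P (F s) (N t) \<omega> = indicator B \<omega> * N s \<omega>"
          by eventually_elim simp
      qed (use BP int in measurable)
      finally show ?thesis .
    qed
    \<comment> \<open>\<open>N\<close> is right-continuous and \<open>A\<close> continuous. The
      identity \<open>X = N + A\<close> is available only at nonnegative times, which includes all
      times to the right of \<open>t\<close>.\<close>
    show "((\<lambda>t. X t \<omega>) \<longlongrightarrow> X t \<omega>) (at_right t)" if t: "0 \<le> t" and \<omega>: "\<omega> \<in> space P" for t \<omega>
    proof -
      have "((\<lambda>v. A v \<omega>) \<longlongrightarrow> A t \<omega>) (at t within {0..})"
        using A(1)[OF \<omega>] t by (auto simp: continuous_on_def)
      then have "((\<lambda>v. A v \<omega>) \<longlongrightarrow> A t \<omega>) (at_right t)"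
        by (rule tendsto_within_subset) (use t in auto)
      then have "((\<lambda>v. N v \<omega> + A v \<omega>) \<longlongrightarrow> N t \<omega> + A t \<omega>) (at_right t)"
        using N(2)[OF \<omega>] t by (intro tendsto_add) (auto simp: cadlag_def)
      moreover have "eventually (\<lambda>v. N v \<omega> + A v \<omega> = X v \<omega>) (at_right t)"
        using t \<omega> by (auto simp: eventually_at_right_field X_eq intro!: exI[of _ "t + 1"])
      ultimately show ?thesis
        using X_eq[OF t \<omega>] by (simp add: tendsto_cong)
    qed
    show "continuous_on {0..} (\<lambda>t. A t \<omega>)" "mono_on {0..} (\<lambda>t. A t \<omega>)" if "\<omega> \<in> space P" for \<omega>
      using A that by auto
    show "\<exists>w. t < w \<and> w \<le> v \<and> X w \<omega> = 0"
      if "\<omega> \<in> space P" "0 \<le> t" "A t \<omega> < A v \<omega>" "t < v" for \<omega> t v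
      using zero_between_of_stieltjes[OF A(1-3)[OF that(1)] that(2,4,3)] by auto
    show "sets P = sigma_sets (space P) (\<Union>t\<in>{0..}. sets (F t))" by (rule gen(2))
  qed
  then show ?thesis by blast
qed

text \<open>The extension lemma is applied to \<open>G\<close> at integer times. Since
  \<open>G k\<close> is contained in \<open>F k\<close>, consistency on \<open>F\<close> carries
  over to \<open>G\<close>; since \<open>F t\<close> is contained in \<open>G k\<close> for k > t,
  the measure obtained has the right values on every \<open>F t\<close> with
  \<open>t \<ge> n\<close>.\<close>

lemma (in generated_class_Sigma_decomposition) flat_measure_extension:
  assumes "property_P P F"
  shows "\<exists>\<nu>. sets \<nu> = sets P \<and>
    (\<forall>t B. real n \<le> t \<and> B \<in> sets (F t) \<longrightarrow> emeasure \<nu> B = emeasure (flat_measure (real n) t) B)"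
proof -
  obtain G where G: "filtration_on_halfline (space P) G"
    and FG_all: "\<forall>t\<ge>0. sets (F t) = (\<Inter>s\<in>{t<..}. sets (G s))"
    and cg: "\<forall>t\<ge>0. \<exists>C. countable C \<and> C \<subseteq> Pow (space P) \<and> sets (G t) = sigma_sets (space P) C"
    and pq: "\<forall>t\<ge>0. \<exists>(\<pi> :: 'a \<Rightarrow> 'a) T. polish_quotient_map (G t) \<pi> T"
    and atoms: "\<forall>\<omega> :: nat \<Rightarrow> 'a. range \<omega> \<subseteq> space P \<and>
      (\<forall>N. (\<Inter>n\<le>N. atom_of (G (real n)) (\<omega> n)) \<noteq> {}) \<longrightarrow> (\<Inter>n. atom_of (G (real n)) (\<omega> n)) \<noteq> {}"
    using assms unfolding property_P_def by (elim conjE exE) (rule that)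
  note FG = FG_all[rule_format]
  have spG: "space (G t) = space P" if "0 \<le> t" for t
    using G that by (simp add: filtration_on_halfline_iff)
  have G_mono: "sets (G s) \<subseteq> sets (G t)" if "0 \<le> s" "s \<le> t" for s t
    using G that by (simp add: filtration_on_halfline_iff)
  have GF: "sets (G t) \<subseteq> sets (F t)" if "0 \<le> t" for t
    unfolding FG[OF that] using G_mono[OF that] by (intro INT_greatest) auto
  have FG': "sets (F t) \<subseteq> sets (G s)" if "0 \<le> t" "t < s" for s t
    unfolding FG[OF that(1)] using that(2) by blast
  have GP: "sets (G t) \<subseteq> sets P" if "0 \<le> t" for t
    using GF[OF that] sets_F[OF that] by blast
  \<comment> \<open>A flat period that starts at \<open>n\<close> must end at \<open>n\<close> or
    later, hence the maximum. \<open>G k\<close> is contained in \<open>F (r k)\<close>, on which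
    the measures are consistent.\<close>
  define r where "r k = real (max k n)" for k
  have r: "real n \<le> r k" "real k \<le> r k" "r k \<le> r (Suc k)" for k by (auto simp: r_def)
  define \<mu> where "\<mu> k = restr_to_subalg (flat_measure (real n) (r k)) (G (real k))" for k
  have sub: "subalgebra (flat_measure (real n) (r k)) (G (real k))" for k
    using spG GP by (simp add: subalgebra_def)
  have sets_\<mu>: "sets (\<mu> k) = sets (G (real k))" and space_\<mu>: "space (\<mu> k) = space P" for k
    using sub by (simp_all add: \<mu>_def sets_restr_to_subalg space_restr_to_subalg)
  have val: "emeasure (\<mu> k) B = emeasure (flat_measure (real n) (r k)) B" if "B \<in> sets (G (real k))" for k B
    unfolding \<mu>_def by (rule emeasure_restr_to_subalg[OF sub that])
  have "\<exists>\<nu>. space \<nu> = space P \<and> sets \<nu> = sigma_sets (space P) (\<Union>k. sets (\<mu> k)) \<and>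
    (\<forall>k. \<forall>B\<in>sets (\<mu> k). emeasure \<nu> B = emeasure (\<mu> k) B)"
  proof (rule projective_family_extension)
    show "space (\<mu> k) = space P" for k by (rule space_\<mu>)
    show "finite_measure (\<mu> k)" for k
    proof (rule finite_measureI)
      have "space P \<in> sets (G (real k))" using sets.top[of "G (real k)"] spG by simp
      then show "emeasure (\<mu> k) (space (\<mu> k)) \<noteq> \<infinity>"
        using r(1) by (simp add: space_\<mu> val emeasure_flat_measure)
    qed
    show "sets (\<mu> k) \<subseteq> sets (\<mu> (Suc k))" for k
      unfolding sets_\<mu> by (rule G_mono) auto
    show "emeasure (\<mu> (Suc k)) B = emeasure (\<mu> k) B" if B: "B \<in> sets (\<mu> k)" for k B
    proof -
      have B': "B \<in> sets (G (real k))" "B \<in> sets (G (real (Suc k)))"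
        using B G_mono[of "real k" "real (Suc k)"] by (auto simp: sets_\<mu>)
      have BF: "B \<in> sets (F (r k))"
        using B'(1) GF[of "real k"] F_mono[of "real k" "r k"] r(2) by auto
      show ?thesis
        unfolding val[OF B'(1)] val[OF B'(2)] by (rule flat_measure_extends[OF _ r(1) r(3) BF]) simp
    qed
    show "\<exists>C. countable C \<and> C \<subseteq> Pow (space P) \<and> sets (\<mu> k) = sigma_sets (space P) C" for k
      unfolding sets_\<mu> by (rule cg[rule_format]) simp
    show "\<exists>(\<pi> :: 'a \<Rightarrow> 'a) T. polish_quotient_map (\<mu> k) \<pi> T" for k
    proof -
      have "polish_quotient_map (\<mu> k) \<pi> T \<longleftrightarrow> polish_quotient_map (G (real k)) \<pi> T"
        for \<pi> :: "'a \<Rightarrow> 'a" and T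
        by (simp add: polish_quotient_map_def sets_\<mu> space_\<mu> spG)
      then show ?thesis using pq by simp
    qed
    show "(\<Inter>k. atom_of (\<mu> k) (\<omega> k)) \<noteq> {}"
      if "range \<omega> \<subseteq> space P" "\<And>N. (\<Inter>k\<le>N. atom_of (\<mu> k) (\<omega> k)) \<noteq> {}" for \<omega> :: "nat \<Rightarrow> 'a"
      using atoms[rule_format, of \<omega>] that by (simp add: atom_of_def sets_\<mu>)
  qed
  then obtain \<nu> where space_\<nu>: "space \<nu> = space P" and \<nu>: "sets \<nu> = sigma_sets (space P) (\<Union>k. sets (G (real k)))"
    "\<And>k B. B \<in> sets (G (real k)) \<Longrightarrow> emeasure \<nu> B = emeasure (flat_measure (real n) (r k)) B"
    by (auto simp: sets_\<mu> val)
  have "sets \<nu> = sets P"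
  proof
    show "sets \<nu> \<subseteq> sets P"
      unfolding \<nu>(1) by (intro sets.sigma_sets_subset UN_least GP) simp
    have "(\<Union>t\<in>{0..}. sets (F t)) \<subseteq> sets \<nu>"
    proof (rule UN_least)
      fix t :: real assume t: "t \<in> {0..}"
      obtain k :: nat where "t < real k" using reals_Archimedean2 by blast
      then have "sets (F t) \<subseteq> sets (G (real k))" using FG' t by simp
      then show "sets (F t) \<subseteq> sets \<nu>" unfolding \<nu>(1) by (auto intro: sigma_sets.Basic)
    qed
    then show "sets P \<subseteq> sets \<nu>"
      unfolding generated space_\<nu>[symmetric] by (rule sets.sigma_sets_subset)
  qed
  moreover have "emeasure \<nu> B = emeasure (flat_measure (real n) t) B"
    if t: "real n \<le> t" and B: "B \<in> sets (F t)" for t B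
  proof -
    obtain k :: nat where k: "t < real k" using reals_Archimedean2 by blast
    have "B \<in> sets (G (real k))" using FG'[of t "real k"] k t B by auto
    then have "emeasure \<nu> B = emeasure (flat_measure (real n) (r k)) B" by (rule \<nu>(2))
    also have "\<dots> = emeasure (flat_measure (real n) t) B"
      using k r(2)[of k] by (intro flat_measure_extends t B) simp_all
    finally show ?thesis .
  qed
  ultimately show ?thesis by blast
qed

theorem theorem2p4:
  fixes P :: "'a measure" and F :: "real \<Rightarrow> 'a measure" and X :: "real \<Rightarrow> 'a \<Rightarrow> real"
  assumes "prob_space P"
    and "property_P P F"
    and "class_Sigma P F X"
  shows "\<exists>!Q :: 'a measure.
    space Q = space P \<and> sets Q = sets P \<and> sigma_finite_measure Q \<and>
    {\<omega> \<in> space Q. last_zero X \<omega> = \<infinity>} \<in> null_sets (completion Q) \<and>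
    (\<forall>t\<ge>0. \<forall>f :: 'a \<Rightarrow> real. f \<in> borel_measurable (F t) \<and> bounded (f ` space P) \<longrightarrow>
       integrable (completion Q) (\<lambda>\<omega>. f \<omega> * indicator {\<omega>. last_zero X \<omega> \<le> ennreal t} \<omega>) \<and>
       (\<integral>\<omega>. f \<omega> * indicator {\<omega>. last_zero X \<omega> \<le> ennreal t} \<omega> \<partial>completion Q)
         = (\<integral>\<omega>. f \<omega> * X t \<omega> \<partial>P))"
proof -
  obtain N A where "generated_class_Sigma_decomposition P F N A X"
    using class_Sigma_decomposition_exists[OF assms] by blast
  then interpret generated_class_Sigma_decomposition P F N A X .
  have "\<forall>n. \<exists>\<nu>. sets \<nu> = sets P \<and>
    (\<forall>t B. real n \<le> t \<and> B \<in> sets (F t) \<longrightarrow> emeasure \<nu> B = emeasure (flat_measure (real n) t) B)"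
    using flat_measure_extension[OF assms(2)] by blast
  from choice[OF this] obtain \<nu> where \<nu>: "\<forall>n. sets (\<nu> n) = sets P \<and>
    (\<forall>t B. real n \<le> t \<and> B \<in> sets (F t) \<longrightarrow> emeasure (\<nu> n) B = emeasure (flat_measure (real n) t) B)" ..
  obtain Q where Q: "represents Q"
    using represents_exists[of \<nu>] \<nu> by blast
  show ?thesis
  proof (rule ex1I[of _ Q], intro conjI allI impI)
    show "sets Q = sets P" using Q by (simp add: represents_def)
    then show "space Q = space P" by (rule sets_eq_imp_space_eq)
    show "sigma_finite_measure Q" by (rule represents_sigma_finite[OF Q])
    show "{\<omega> \<in> space Q. last_zero X \<omega> = \<infinity>} \<in> null_sets (completion Q)"
      by (rule represents_last_zero_infinite[OF Q])
    fix t :: real and f :: "'a \<Rightarrow> real"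
    assume "0 \<le> t" and f: "f \<in> borel_measurable (F t) \<and> bounded (f ` space P)"
    note int = represents_last_zero_integral[OF Q \<open>0 \<le> t\<close> f[THEN conjunct1] f[THEN conjunct2]]
    show "integrable (completion Q) (\<lambda>\<omega>. f \<omega> * indicator {\<omega>. last_zero X \<omega> \<le> ennreal t} \<omega>)"
      by (rule int)
    show "(\<integral>\<omega>. f \<omega> * indicator {\<omega>. last_zero X \<omega> \<le> ennreal t} \<omega> \<partial>completion Q) = (\<integral>\<omega>. f \<omega> * X t \<omega> \<partial>P)"
      by (rule int)
  next
    fix R :: "'a measure"
    assume R: "space R = space P \<and> sets R = sets P \<and> sigma_finite_measure R \<and>
    {\<omega> \<in> space R. last_zero X \<omega> = \<infinity>} \<in> null_sets (completion R) \<and>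
    (\<forall>t\<ge>0. \<forall>f :: 'a \<Rightarrow> real. f \<in> borel_measurable (F t) \<and> bounded (f ` space P) \<longrightarrow>
       integrable (completion R) (\<lambda>\<omega>. f \<omega> * indicator {\<omega>. last_zero X \<omega> \<le> ennreal t} \<omega>) \<and>
       (\<integral>\<omega>. f \<omega> * indicator {\<omega>. last_zero X \<omega> \<le> ennreal t} \<omega> \<partial>completion R)
         = (\<integral>\<omega>. f \<omega> * X t \<omega> \<partial>P))"
    \<comment> \<open>For uniqueness the indicators among the bounded test functions are
      enough.\<close>
    have ind: "(indicator B :: 'a \<Rightarrow> real) \<in> borel_measurable (F t) \<and> bounded ((indicator B :: 'a \<Rightarrow> real) ` space P)"
      if "B \<in> sets (F t)" for t B
      using that by (auto simp: bounded_iff indicator_def intro!: exI[of _ 1])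
    have "represents R"
      by (rule representsI) (use R ind in blast)+
    then show "R = Q" using represents_unique Q by blast
  qed
qed

end
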